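(* Let $G=(V,E)$ be a complete graph with metric cost $c:E\to\mathbb{R}_+$ and distinct endpoints $s,t\in V$. Let $x^*$ be an optimal solution to the path-variant Held-Karp relaxation, written as a convex combination $x^*=\sum_{i=1}^k\lambda_i\chi_{\mathscr{T}_i}$ of incidence vectors of spanning trees. Let $\mathscr{T}$ be sampled as $\mathscr{T}_i$ with probability $\lambda_i$; let $T$ be the set of vertices in $V\setminus\{s,t\}$ of odd degree in $\mathscr{T}$ together with those of $s,t$ of even degree in $\mathscr{T}$; let $J$ be a minimum-cost $T$-join; and let $H$ be the Hamiltonian $s$-$t$ path obtained by shortcutting an Eulerian $s$-$t$ path of the multigraph $\mathscr{T}\cup J$. Then $\mathbb{E}[c(H)]\le\frac53c(x^* )$.
   Context: For $F\subseteq E$, $\chi_F$ is its incidence vector; $x(F)=\sum_{e\in F}x_e$; $c(x)=\sum_ec_ex_e$; $\delta(S)$ is the set of edges with exactly one endpoint in $S$. The path-variant Held-Karp relaxation: minimize $c(x)$ subject to $x(\delta(S))\ge1$ for all $S\subsetneq V$ with $|S\cap\{s,t\}|=1$; $x(\delta(S))\ge2$ for all nonempty $S\subsetneq V$ with $|S\cap\{s,t\}|\ne1$; $x(\delta(\{s\}))=x(\delta(\{t\}))=1$; $x(\delta(\{v\}))=2$ for $v\in V\setminus\{s,t\}$; $x\ge0$. Its feasible region lies in the spanning tree polytope, so such a decomposition exists. A $T$-join is an edge set whose set of odd-degree vertices is exactly $T$. *)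

theory Defs
  imports "HOL-Probability.Probability_Mass_Function" "HOL-Library.Sublist" "HOL-Library.Multiset"
begin

section \<open>Complete graphs and metric costs\<close>

text \<open>An undirected edge is the two-element set of its endpoints, an edge set has type
  \<^typ>\<open>'a set set\<close>, and a multigraph on a vertex set is a multiset of edges.  Edge vectors and edge
  costs are functions \<^typ>\<open>'a set \<Rightarrow> real\<close>; their values outside the edge set are never used.\<close>

definition complete_edges :: "'a set \<Rightarrow> 'a set set" where
  "complete_edges V = {e. e \<subseteq> V \<and> card e = 2}"

definition metric_cost :: "'a set \<Rightarrow> ('a set \<Rightarrow> real) \<Rightarrow> bool" where
  "metric_cost V c \<longleftrightarrow>
     (\<forall>e\<in>complete_edges V. 0 \<le> c e) \<and>
     (\<forall>u\<in>V. \<forall>v\<in>V. \<forall>w\<in>V. u \<noteq> v \<longrightarrow> v \<noteq> w \<longrightarrow> u \<noteq> w \<longrightarrow> c {u, w} \<le> c {u, v} + c {v, w})"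

definition edge_cut :: "'a set \<Rightarrow> 'a set \<Rightarrow> 'a set set" where
  "edge_cut V S = {e \<in> complete_edges V. card (e \<inter> S) = 1}"

definition cost :: "'a set \<Rightarrow> ('a set \<Rightarrow> real) \<Rightarrow> ('a set \<Rightarrow> real) \<Rightarrow> real" where
  "cost V c x = (\<Sum>e\<in>complete_edges V. c e * x e)"

section \<open>The path-variant Held-Karp relaxation\<close>

definition held_karp_path_feasible :: "'a set \<Rightarrow> 'a \<Rightarrow> 'a \<Rightarrow> ('a set \<Rightarrow> real) \<Rightarrow> bool" where
  "held_karp_path_feasible V s t x \<longleftrightarrow>
     (\<forall>S. S \<subset> V \<and> card (S \<inter> {s, t}) = 1 \<longrightarrow> 1 \<le> sum x (edge_cut V S)) \<and>
     (\<forall>S. S \<noteq> {} \<and> S \<subset> V \<and> card (S \<inter> {s, t}) \<noteq> 1 \<longrightarrow> 2 \<le> sum x (edge_cut V S)) \<and>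
     sum x (edge_cut V {s}) = 1 \<and> sum x (edge_cut V {t}) = 1 \<and>
     (\<forall>v\<in>V - {s, t}. sum x (edge_cut V {v}) = 2) \<and>
     (\<forall>e\<in>complete_edges V. 0 \<le> x e)"

definition held_karp_path_optimal ::
  "'a set \<Rightarrow> 'a \<Rightarrow> 'a \<Rightarrow> ('a set \<Rightarrow> real) \<Rightarrow> ('a set \<Rightarrow> real) \<Rightarrow> bool" where
  "held_karp_path_optimal V s t c x \<longleftrightarrow>
     held_karp_path_feasible V s t x \<and>
     (\<forall>y. held_karp_path_feasible V s t y \<longrightarrow> cost V c x \<le> cost V c y)"

section \<open>Walks and spanning trees\<close>

text \<open>A walk is given by its list of vertices.\<close>

definition walk_edges :: "'a list \<Rightarrow> 'a set list" where
  "walk_edges p = map2 (\<lambda>u v. {u, v}) p (tl p)"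

definition walk_cost :: "('a set \<Rightarrow> real) \<Rightarrow> 'a list \<Rightarrow> real" where
  "walk_cost c p = sum_list (map c (walk_edges p))"

definition connected_edges :: "'a set \<Rightarrow> 'a set set \<Rightarrow> bool" where
  "connected_edges V F \<longleftrightarrow> (\<forall>u\<in>V. \<forall>v\<in>V. (u, v) \<in> {(a, b). {a, b} \<in> F}\<^sup>*)"

text \<open>A cycle is listed without repeating its initial vertex at the end.\<close>

definition cycle_in :: "'a set set \<Rightarrow> 'a list \<Rightarrow> bool" where
  "cycle_in F p \<longleftrightarrow> 3 \<le> length p \<and> distinct p \<and> set (walk_edges (p @ [hd p])) \<subseteq> F"

definition spanning_tree :: "'a set \<Rightarrow> 'a set set \<Rightarrow> bool" where
  "spanning_tree V F \<longleftrightarrow>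
     F \<subseteq> complete_edges V \<and> connected_edges V F \<and> (\<nexists>p. cycle_in F p)"

section \<open>Joins\<close>

definition edge_degree :: "'a set set \<Rightarrow> 'a \<Rightarrow> nat" where
  "edge_degree F v = card {e \<in> F. v \<in> e}"

definition is_join :: "'a set \<Rightarrow> 'a set \<Rightarrow> 'a set set \<Rightarrow> bool" where
  "is_join V T J \<longleftrightarrow> J \<subseteq> complete_edges V \<and> {v \<in> V. odd (edge_degree J v)} = T"

definition min_cost_join :: "'a set \<Rightarrow> ('a set \<Rightarrow> real) \<Rightarrow> 'a set \<Rightarrow> 'a set set \<Rightarrow> bool" where
  "min_cost_join V c T J \<longleftrightarrow>
     is_join V T J \<and> (\<forall>J'. is_join V T J' \<longrightarrow> sum c J \<le> sum c J')"

definition wrong_degree_set :: "'a set \<Rightarrow> 'a \<Rightarrow> 'a \<Rightarrow> 'a set set \<Rightarrow> 'a set" where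
  "wrong_degree_set V s t F =
     {v \<in> V - {s, t}. odd (edge_degree F v)} \<union> {v \<in> {s, t}. even (edge_degree F v)}"

section \<open>Eulerian paths and shortcutting\<close>

text \<open>An Eulerian path uses every edge of the multigraph exactly as often as its multiplicity.
  It is also required to visit every vertex.\<close>

definition eulerian_path :: "'a set \<Rightarrow> 'a set multiset \<Rightarrow> 'a \<Rightarrow> 'a \<Rightarrow> 'a list \<Rightarrow> bool" where
  "eulerian_path V M s t p \<longleftrightarrow>
     p \<noteq> [] \<and> hd p = s \<and> last p = t \<and> set p = V \<and> mset (walk_edges p) = M"

definition hamiltonian_path :: "'a set \<Rightarrow> 'a \<Rightarrow> 'a \<Rightarrow> 'a list \<Rightarrow> bool" where
  "hamiltonian_path V s t h \<longleftrightarrow>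
     h \<noteq> [] \<and> hd h = s \<and> last h = t \<and> distinct h \<and> set h = V"

text \<open>Shortcutting deletes repeated occurrences of vertices.  Which occurrence of a vertex is kept
  is left open, apart from the walk's two endpoints staying in place.\<close>

definition shortcut_path :: "'a set \<Rightarrow> 'a \<Rightarrow> 'a \<Rightarrow> 'a list \<Rightarrow> 'a list \<Rightarrow> bool" where
  "shortcut_path V s t p h \<longleftrightarrow> hamiltonian_path V s t h \<and> subseq h p"

end

theory Submission
  imports Defs
begin

text \<open>For a tree \<open>F\<close> of the decomposition, the vector \<open>(\<chi>\<^sub>F + x) / 3\<close> puts total weight at least 1 on
  every cut whose shore contains an odd number of wrong-degree vertices.  By the theorem of Edmonds
  and Johnson a cheapest join therefore costs at most \<open>(c(F) + c(x)) / 3\<close>, and averaging over the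
  trees bounds tree plus join by \<open>5/3 c(x)\<close>.

  The Edmonds-Johnson theorem is proved in the form: a vector \<open>y\<close> covering all \<open>T\<close>-odd cuts dominates
  the edge marginals of a random \<open>T\<close>-join.  The induction is on the number of vertices, then on the
  number of non-tight constraints.  An edge of weight at least 1 is contracted; a tight cut with two
  non-singleton shores is split by contracting either shore, the two random joins being coupled
  along the single edge in which each crosses the cut; an edge in no tight cut is decreased.
  Otherwise all tight cuts are stars, and counting edges against tight vertices gives a direction
  in which \<open>y\<close> can be moved both ways until a new constraint becomes tight.\<close>

section \<open>Cut covers and random \<open>T\<close>-joins\<close>

text \<open>Edges are labels with endpoint maps rather than vertex pairs, so that a contraction
  changes only the maps: \<open>E\<close> and \<open>y\<close> stay as they are, and the loops and
  parallel edges it creates need no special treatment. A loop crosses no set.\<close>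

definition crossing :: "('e \<Rightarrow> 'v) \<Rightarrow> ('e \<Rightarrow> 'v) \<Rightarrow> 'v set \<Rightarrow> 'e set" where
  "crossing a b S = {e. (a e \<in> S) \<noteq> (b e \<in> S)}"

lemma crossing_comp: "crossing (r \<circ> a) (r \<circ> b) S = crossing a b (r -` S)"
  by (auto simp: crossing_def)

text \<open>Handshake count modulo 2: summing the star cuts over \<open>S\<close> counts a non-loop
  once per endpoint in \<open>S\<close>, so edges inside \<open>S\<close> cancel and only the
  crossing ones survive.\<close>

lemma odd_card_crossing:
  assumes "finite J" "finite S"
  shows "odd (card (J \<inter> crossing a b S)) \<longleftrightarrow>
    odd (card {v \<in> S. odd (card (J \<inter> crossing a b {v}))})"
proof -
  have 1: "odd (card {v \<in> S. e \<in> crossing a b {v}}) \<longleftrightarrow> e \<in> crossing a b S" for e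
  proof -
    have "{v \<in> S. e \<in> crossing a b {v}} = (if a e = b e then {} else S \<inter> {a e, b e})"
      by (auto simp: crossing_def)
    then show ?thesis
      by (auto simp: crossing_def Int_insert_right)
  qed
  have card_of_bool: "card {z \<in> Z. P z} = (\<Sum>z\<in>Z. of_bool (P z))" if "finite Z" for Z :: "'z set" and P
    using that by (simp add: Int_def)
  have "(\<Sum>v\<in>S. card (J \<inter> crossing a b {v})) = (\<Sum>v\<in>S. card {e \<in> J. e \<in> crossing a b {v}})"
    by (simp add: Int_def)
  also have "\<dots> = (\<Sum>v\<in>S. \<Sum>e\<in>J. of_bool (e \<in> crossing a b {v}))"
    using assms by (simp add: card_of_bool)
  also have "\<dots> = (\<Sum>e\<in>J. \<Sum>v\<in>S. of_bool (e \<in> crossing a b {v}))"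
    by (rule sum.swap)
  also have "\<dots> = (\<Sum>e\<in>J. card {v \<in> S. e \<in> crossing a b {v}})"
    using assms by (simp add: card_of_bool)
  finally have "odd (\<Sum>v\<in>S. card (J \<inter> crossing a b {v})) \<longleftrightarrow> odd (\<Sum>e\<in>J. card {v \<in> S. e \<in> crossing a b {v}})"
    by simp
  moreover have "{e \<in> J. e \<in> crossing a b S} = J \<inter> crossing a b S" by auto
  ultimately show ?thesis
    using assms by (simp add: even_sum_iff 1)
qed

text \<open>Degrees are read off the star cuts, where a loop counts 0 instead of 2. Only parity
  matters, so this is the usual notion.\<close>

definition T_join :: "('e \<Rightarrow> 'v) \<Rightarrow> ('e \<Rightarrow> 'v) \<Rightarrow> 'v set \<Rightarrow> 'e set \<Rightarrow> 'v set \<Rightarrow> 'e set \<Rightarrow> bool" where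
  "T_join a b V E T J \<longleftrightarrow>
     J \<subseteq> E \<and> (\<forall>v\<in>V. odd (card (J \<inter> crossing a b {v})) \<longleftrightarrow> v \<in> T)"

text \<open>Membership of \<open>y\<close> in the dominant of the \<open>T\<close>-join polytope;
  the convex combination of joins is written as a distribution \<open>p\<close>, whose edge
  marginals are the coordinates of the combined vector.\<close>

definition join_dominated ::
  "('e \<Rightarrow> 'v) \<Rightarrow> ('e \<Rightarrow> 'v) \<Rightarrow> 'v set \<Rightarrow> 'e set \<Rightarrow> 'v set \<Rightarrow> ('e \<Rightarrow> real) \<Rightarrow> bool" where
  "join_dominated a b V E T y \<longleftrightarrow>
     (\<exists>p. (\<forall>J\<in>set_pmf p. T_join a b V E T J) \<and>
          (\<forall>e\<in>E. measure_pmf.prob p {J. e \<in> J} \<le> y e))"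

lemma join_dominated_mono:
  assumes "join_dominated a b V E T y" "\<And>e. e \<in> E \<Longrightarrow> y e \<le> y' e"
  shows "join_dominated a b V E T y'"
  using assms unfolding join_dominated_def by (meson order.trans)

text \<open>A coin of bias \<open>l\<close> decides from which of the two distributions the join is
  drawn, so the edge marginals mix with the same weights.\<close>

lemma join_dominated_convex:
  assumes "join_dominated a b V E T y1" "join_dominated a b V E T y2" "0 \<le> l" "l \<le> 1"
  shows "join_dominated a b V E T (\<lambda>e. l * y1 e + (1 - l) * y2 e)"
proof -
  obtain p1 where p1: "\<forall>J\<in>set_pmf p1. T_join a b V E T J"
      "\<And>e. e \<in> E \<Longrightarrow> measure_pmf.prob p1 {J. e \<in> J} \<le> y1 e"
    using assms(1) unfolding join_dominated_def by blast
  obtain p2 where p2: "\<forall>J\<in>set_pmf p2. T_join a b V E T J"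
      "\<And>e. e \<in> E \<Longrightarrow> measure_pmf.prob p2 {J. e \<in> J} \<le> y2 e"
    using assms(2) unfolding join_dominated_def by blast
  let ?q = "bernoulli_pmf l \<bind> (\<lambda>c. if c then p1 else p2)"
  have "\<forall>J\<in>set_pmf ?q. T_join a b V E T J"
    using p1(1) p2(1) by (auto split: if_splits)
  moreover have "measure_pmf.prob ?q {J. e \<in> J} \<le> l * y1 e + (1 - l) * y2 e" if "e \<in> E" for e
  proof -
    have "measure_pmf.prob ?q X = l * measure_pmf.prob p1 X + (1 - l) * measure_pmf.prob p2 X" for X
    proof -
      have prob_eq: "measure_pmf.prob q X = pmf (map_pmf (\<lambda>J. J \<in> X) q) True" for q :: "'a set pmf"
        by (simp add: pmf_map vimage_def)
      have "map_pmf (\<lambda>J. J \<in> X) ?q =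
          bernoulli_pmf l \<bind> (\<lambda>c. if c then map_pmf (\<lambda>J. J \<in> X) p1 else map_pmf (\<lambda>J. J \<in> X) p2)"
        by (simp add: map_bind_pmf if_distrib)
      then show ?thesis
        using assms(3,4) by (simp add: prob_eq pmf_bind)
    qed
    then show ?thesis
      using p1(2)[OF that] p2(2)[OF that] assms(3,4)
      by (simp add: add_mono mult_left_mono)
  qed
  ultimately show ?thesis
    unfolding join_dominated_def by blast
qed

section \<open>Ratio test and elimination\<close>

text \<open>Ratio test: with slacks \<open>\<alpha>\<close> changing at rates
  \<open>\<beta>\<close>, the step ends when the first slack reaches zero. The negative rate at
  \<open>k\<close> makes it finite; tight constraints have rate 0 and do not block it.\<close>

lemma first_tight_step:
  fixes \<alpha> \<beta> :: "'i \<Rightarrow> real"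
  assumes "finite I" and nonneg: "\<And>i. i \<in> I \<Longrightarrow> 0 \<le> \<alpha> i"
    and tight: "\<And>i. i \<in> I \<Longrightarrow> \<alpha> i = 0 \<Longrightarrow> \<beta> i = 0"
    and "k \<in> I" "\<beta> k < 0"
  shows "\<exists>\<epsilon>>0. (\<forall>i\<in>I. 0 \<le> \<alpha> i + \<epsilon> * \<beta> i) \<and> (\<exists>j\<in>I. 0 < \<alpha> j \<and> \<alpha> j + \<epsilon> * \<beta> j = 0)"
proof -
  let ?N = "{i \<in> I. \<beta> i < 0}"
  define \<epsilon> where "\<epsilon> = Min ((\<lambda>i. \<alpha> i / - \<beta> i) ` ?N)"
  have fin: "finite ((\<lambda>i. \<alpha> i / - \<beta> i) ` ?N)" and ne: "(\<lambda>i. \<alpha> i / - \<beta> i) ` ?N \<noteq> {}"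
    using assms by auto
  have pos: "0 < \<alpha> i" if "i \<in> ?N" for i
    using that nonneg[of i] tight[of i] by force
  obtain j where j: "j \<in> ?N" "\<epsilon> = \<alpha> j / - \<beta> j"
    using Min_in[OF fin ne] unfolding \<epsilon>_def by blast
  have "0 < \<epsilon>"
    using j pos[OF j(1)] by (simp add: divide_pos_neg)
  moreover have "0 \<le> \<alpha> i + \<epsilon> * \<beta> i" if "i \<in> I" for i
  proof (cases "\<beta> i < 0")
    case True
    then have "\<epsilon> \<le> \<alpha> i / - \<beta> i"
      unfolding \<epsilon>_def using fin that by (intro Min_le) auto
    then show ?thesis
      using True by (simp add: field_simps)
  next
    case False
    then show ?thesis
      using \<open>0 < \<epsilon>\<close> nonneg[OF that] by simp
  qed
  moreover have "\<alpha> j + \<epsilon> * \<beta> j = 0"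
    using j by simp
  ultimately show ?thesis
    using j(1) pos[OF j(1)] by blast
qed

text \<open>Gaussian elimination: each nontrivial equation removes one unknown, so an unknown is
  left over when the equations run out.\<close>

lemma underdetermined_system_solution:
  fixes m :: "'i \<Rightarrow> 'e \<Rightarrow> real"
  assumes "finite A" "finite E" "card A < card E"
  shows "\<exists>z. (\<exists>e\<in>E. z e \<noteq> 0) \<and> (\<forall>v\<in>A. (\<Sum>e\<in>E. m v e * z e) = 0)"
  using assms
proof (induction A arbitrary: E m rule: finite_induct)
  case empty
  then obtain e where "e \<in> E" by fastforce
  then show ?case by (intro exI[of _ "\<lambda>_. 1"]) auto
next
  case (insert v A)
  show ?case
  proof (cases "\<forall>e\<in>E. m v e = 0")
    case True
    then show ?thesis
      using insert.IH[of E m] insert.prems insert.hyps by auto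
  next
    case False
    then obtain f where f: "f \<in> E" "m v f \<noteq> 0" by blast
    \<comment> \<open>Row operation that clears column \<open>f\<close> by subtracting a multiple of
      row \<open>v\<close>.\<close>
    define m' where "m' = (\<lambda>u e. m u e - m u f * m v e / m v f)"
    have "card A < card (E - {f})"
      using insert f by simp
    then obtain z where z: "\<exists>e\<in>E - {f}. z e \<noteq> 0" "\<forall>u\<in>A. (\<Sum>e\<in>E - {f}. m' u e * z e) = 0"
      using insert.IH[of "E - {f}" m'] insert.prems by auto
    let ?s = "\<Sum>e\<in>E - {f}. m v e * z e"
    \<comment> \<open>The eliminated unknown is recovered by solving equation \<open>v\<close> for
      it.\<close>
    define z' where "z' = z(f := - ?s / m v f)"
    have eq: "(\<Sum>e\<in>E. m u e * z' e) = (\<Sum>e\<in>E - {f}. m u e * z e) - m u f * ?s / m v f" for u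
    proof -
      have "(\<Sum>e\<in>E. m u e * z' e) = m u f * z' f + (\<Sum>e\<in>E - {f}. m u e * z' e)"
        using insert.prems f by (simp add: sum.remove)
      also have "(\<Sum>e\<in>E - {f}. m u e * z' e) = (\<Sum>e\<in>E - {f}. m u e * z e)"
        by (intro sum.cong) (auto simp: z'_def)
      finally show ?thesis by (simp add: z'_def)
    qed
    have "(\<Sum>e\<in>E. m v e * z' e) = 0"
      using eq[of v] f by simp
    moreover have "(\<Sum>e\<in>E. m u e * z' e) = 0" if "u \<in> A" for u
    proof -
      have "(\<Sum>e\<in>E - {f}. m' u e * z e) = (\<Sum>e\<in>E - {f}. m u e * z e) - (m u f / m v f) * ?s"
        unfolding m'_def by (simp add: left_diff_distrib sum_subtractf sum_distrib_left mult.assoc)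
      then show ?thesis
        using z(2) that eq[of u] by simp
    qed
    moreover have "\<exists>e\<in>E. z' e \<noteq> 0"
      using z(1) unfolding z'_def by auto
    ultimately show ?thesis by blast
  qed
qed

section \<open>The polyhedron of cut covers\<close>

locale T_cut_cover =
  fixes a b :: "'e \<Rightarrow> 'v" and V :: "'v set" and E :: "'e set" and T :: "'v set" and y :: "'e \<Rightarrow> real"
  assumes finite_V: "finite V" and finite_E: "finite E"
    and a_in: "\<And>e. e \<in> E \<Longrightarrow> a e \<in> V" and b_in: "\<And>e. e \<in> E \<Longrightarrow> b e \<in> V"
    and T_sub: "T \<subseteq> V" and even_T: "even (card T)"
    and y_nonneg: "\<And>e. e \<in> E \<Longrightarrow> 0 \<le> y e"
    and covered: "\<And>S. S \<subseteq> V \<Longrightarrow> odd (card (S \<inter> T)) \<Longrightarrow> 1 \<le> sum y (E \<inter> crossing a b S)"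
begin

lemma finite_T: "finite T"
  using finite_V T_sub finite_subset by blast

lemma crossing_Int_V: "E \<inter> crossing a b (S \<inter> V) = E \<inter> crossing a b S"
  using a_in b_in by (auto simp: crossing_def)

lemma crossing_compl: "E \<inter> crossing a b (V - S) = E \<inter> crossing a b S"
  using a_in b_in by (auto simp: crossing_def)

definition T_odd_sets :: "'v set set" where
  "T_odd_sets = {S. S \<subseteq> V \<and> odd (card (S \<inter> T))}"

lemma T_odd_compl:
  assumes "S \<in> T_odd_sets"
  shows "V - S \<in> T_odd_sets"
proof -
  have "T = (S \<inter> T) \<union> ((V - S) \<inter> T)" using T_sub by auto
  then have "card T = card (S \<inter> T) + card ((V - S) \<inter> T)"
    using card_Un_disjoint[of "S \<inter> T" "(V - S) \<inter> T"] finite_T by auto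
  then show ?thesis
    using assms even_T by (auto simp: T_odd_sets_def)
qed

lemma T_odd_nonempty: "S \<in> T_odd_sets \<Longrightarrow> S \<noteq> {} \<and> V - S \<noteq> {}"
  using T_odd_compl[of S] by (auto simp: T_odd_sets_def)

text \<open>Nonnegativity and cut inequalities share one index type, so that the ratio test can
  treat them alike.\<close>

definition constraints :: "('e + 'v set) set" where
  "constraints = E <+> T_odd_sets"

definition slack :: "('e \<Rightarrow> real) \<Rightarrow> 'e + 'v set \<Rightarrow> real" where
  "slack w i = (case i of Inl e \<Rightarrow> w e | Inr S \<Rightarrow> sum w (E \<inter> crossing a b S) - 1)"

definition slack_count :: "('e \<Rightarrow> real) \<Rightarrow> nat" where
  "slack_count w = card {i \<in> constraints. 0 < slack w i}"

lemma finite_constraints: "finite constraints"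
  using finite_E finite_V by (auto simp: constraints_def T_odd_sets_def)

lemma cover_iff_slack:
  "T_cut_cover a b V E T w \<longleftrightarrow> (\<forall>i\<in>constraints. 0 \<le> slack w i)"
proof
  assume "T_cut_cover a b V E T w"
  then interpret w: T_cut_cover a b V E T w .
  show "\<forall>i\<in>constraints. 0 \<le> slack w i"
    using w.y_nonneg w.covered by (auto simp: constraints_def slack_def T_odd_sets_def)
next
  assume *: "\<forall>i\<in>constraints. 0 \<le> slack w i"
  have "0 \<le> w e" if "e \<in> E" for e
    using that bspec[OF *, of "Inl e"] by (auto simp: constraints_def slack_def)
  moreover have "1 \<le> sum w (E \<inter> crossing a b S)" if "S \<subseteq> V" "odd (card (S \<inter> T))" for S
    using that bspec[OF *, of "Inr S"] by (auto simp: constraints_def slack_def T_odd_sets_def)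
  ultimately show "T_cut_cover a b V E T w"
    using finite_V finite_E a_in b_in T_sub even_T by unfold_locales auto
qed

text \<open>A direction that vanishes on all tight constraints keeps them tight. Since
  \<open>f\<close> loses weight, the ratio test stops after a finite step, at which a further
  constraint has become tight.\<close>

lemma perturb:
  assumes zero: "\<And>e. e \<in> E \<Longrightarrow> y e = 0 \<Longrightarrow> z e = 0"
    and tight: "\<And>S. S \<in> T_odd_sets \<Longrightarrow> sum y (E \<inter> crossing a b S) = 1 \<Longrightarrow> sum z (E \<inter> crossing a b S) = 0"
    and neg: "f \<in> E" "z f < 0"
  shows "\<exists>\<epsilon>>0. T_cut_cover a b V E T (\<lambda>e. y e + \<epsilon> * z e) \<and>
     slack_count (\<lambda>e. y e + \<epsilon> * z e) < slack_count y"
proof -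
  define \<beta> where "\<beta> i = (case i of Inl e \<Rightarrow> z e | Inr S \<Rightarrow> sum z (E \<inter> crossing a b S))" for i
  have slack_add: "slack (\<lambda>e. y e + \<epsilon> * z e) i = slack y i + \<epsilon> * \<beta> i" for \<epsilon> i
    by (cases i) (auto simp: slack_def \<beta>_def sum.distrib sum_distrib_left)
  have nonneg: "0 \<le> slack y i" if "i \<in> constraints" for i
    using cover_iff_slack[of y] T_cut_cover_axioms that by blast
  have tight': "\<beta> i = 0" if "i \<in> constraints" "slack y i = 0" for i
    using that zero tight by (auto simp: constraints_def slack_def \<beta>_def)
  have "Inl f \<in> constraints" "\<beta> (Inl f) < 0"
    using neg by (auto simp: constraints_def \<beta>_def)
  then obtain \<epsilon> j where \<epsilon>: "0 < \<epsilon>" "\<forall>i\<in>constraints. 0 \<le> slack y i + \<epsilon> * \<beta> i"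
    and j: "j \<in> constraints" "0 < slack y j" "slack y j + \<epsilon> * \<beta> j = 0"
    using first_tight_step[where I = constraints and \<alpha> = "slack y" and \<beta> = \<beta>, OF finite_constraints nonneg tight'] by blast
  have "{i \<in> constraints. 0 < slack y i + \<epsilon> * \<beta> i} \<subseteq> {i \<in> constraints. 0 < slack y i}"
  proof safe
    fix i assume i: "i \<in> constraints" "0 < slack y i + \<epsilon> * \<beta> i"
    then show "0 < slack y i"
      using nonneg[of i] tight'[of i] by force
  qed
  moreover have "j \<in> {i \<in> constraints. 0 < slack y i}" "j \<notin> {i \<in> constraints. 0 < slack y i + \<epsilon> * \<beta> i}"
    using j by auto
  ultimately have "{i \<in> constraints. 0 < slack y i + \<epsilon> * \<beta> i} \<subset> {i \<in> constraints. 0 < slack y i}"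
    by blast
  then have "slack_count (\<lambda>e. y e + \<epsilon> * z e) < slack_count y"
    unfolding slack_count_def slack_add
    using finite_constraints by (intro psubset_card_mono) auto
  moreover have "T_cut_cover a b V E T (\<lambda>e. y e + \<epsilon> * z e)"
    unfolding cover_iff_slack slack_add using \<epsilon>(2) .
  ultimately show ?thesis
    using \<epsilon>(1) by blast
qed

text \<open>\<open>r\<close> identifies vertices. Cuts of the image graph are cuts of preimages in
  the old one, and \<open>T'\<close> keeps the classes holding an odd number of
  \<open>T\<close>-vertices, so that \<open>T'\<close>-odd sets pull back to \<open>T\<close>-odd
  sets.\<close>

lemma contract:
  assumes "finite V'" "r ` V \<subseteq> V'"
  defines "T' \<equiv> {v \<in> V'. odd (card (T \<inter> r -` {v}))}"
  shows "T_cut_cover (r \<circ> a) (r \<circ> b) V' E T' y"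
proof -
  have parity: "odd (card (S \<inter> T')) \<longleftrightarrow> odd (card ((r -` S \<inter> V) \<inter> T))" if "S \<subseteq> V'" for S
  proof -
    have fS: "finite S" using that assms(1) finite_subset by blast
    have "(r -` S \<inter> V) \<inter> T = (\<Union>v\<in>S. T \<inter> r -` {v})"
      using T_sub by auto
    then have "card ((r -` S \<inter> V) \<inter> T) = (\<Sum>v\<in>S. card (T \<inter> r -` {v}))"
      using card_UN_disjoint[of S "\<lambda>v. T \<inter> r -` {v}"] fS finite_T by auto
    moreover have "{v \<in> S. odd (card (T \<inter> r -` {v}))} = S \<inter> T'"
      using that by (auto simp: T'_def)
    ultimately show ?thesis
      using fS by (simp add: even_sum_iff)
  qed
  show ?thesis
  proof
    have "r -` V' \<inter> V \<inter> T = T" "V' \<inter> T' = T'"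
      using assms(2) T_sub by (auto simp: T'_def)
    then show "even (card T')"
      using parity[of V'] even_T by simp
  next
    fix S assume S: "S \<subseteq> V'" "odd (card (S \<inter> T'))"
    then have "1 \<le> sum y (E \<inter> crossing a b (r -` S \<inter> V))"
      using parity by (intro covered) auto
    then show "1 \<le> sum y (E \<inter> crossing (r \<circ> a) (r \<circ> b) S)"
      by (simp add: crossing_comp crossing_Int_V)
  qed (use assms finite_E a_in b_in y_nonneg in \<open>auto simp: T'_def\<close>)
qed

end

section \<open>Contracting a heavy edge\<close>

lemma odd_card_crossing_pair:
  assumes "finite J" "u \<noteq> w"
  shows "odd (card (J \<inter> crossing a b {u, w})) \<longleftrightarrow>
    (odd (card (J \<inter> crossing a b {u})) \<noteq> odd (card (J \<inter> crossing a b {w})))"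
proof -
  have "{v \<in> {u, w}. odd (card (J \<inter> crossing a b {v}))} =
    (if odd (card (J \<inter> crossing a b {u})) then {u} else {}) \<union>
    (if odd (card (J \<inter> crossing a b {w})) then {w} else {})"
    by auto
  then show ?thesis
    using odd_card_crossing[OF assms(1), of "{u, w}" a b] assms(2) by auto
qed

context T_cut_cover
begin

text \<open>With \<open>1 \<le> y e\<close> the marginal bound at \<open>e\<close> is vacuous, so
  \<open>e\<close> may be added or dropped at will to repair the parity at \<open>a e\<close>. The
  parity of the merged vertex then settles \<open>b e\<close>.\<close>

lemma dominated_contract_edge:
  assumes e: "e \<in> E" "a e \<noteq> b e" "1 \<le> y e"
    and IH: "\<And>(a' :: 'e \<Rightarrow> 'v) b' V' T'. T_cut_cover a' b' V' E T' y \<Longrightarrow> card V' < card V \<Longrightarrow>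
      join_dominated a' b' V' E T' y"
  shows "join_dominated a b V E T y"
proof -
  let ?u = "a e" and ?w = "b e"
  define r where "r = id(?u := ?w)"
  define V' where "V' = V - {?u}"
  define T' where "T' = {v \<in> V'. odd (card (T \<inter> r -` {v}))}"
  have uw: "?u \<in> V" "?w \<in> V" using e a_in b_in by auto
  have cover: "T_cut_cover (r \<circ> a) (r \<circ> b) V' E T' y"
    unfolding T'_def using uw e(2) finite_V by (intro contract) (auto simp: V'_def r_def)
  have "card V' < card V"
    unfolding V'_def using uw finite_V by (intro card_Diff1_less)
  then have "join_dominated (r \<circ> a) (r \<circ> b) V' E T' y"
    by (rule IH[OF cover])
  then obtain p where p: "\<And>J. J \<in> set_pmf p \<Longrightarrow> T_join (r \<circ> a) (r \<circ> b) V' E T' J"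
    and py: "\<And>g. g \<in> E \<Longrightarrow> measure_pmf.prob p {J. g \<in> J} \<le> y g"
    unfolding join_dominated_def by blast
  \<comment> \<open>In the contracted graph \<open>e\<close> is a loop, so its presence in
    \<open>J\<close> carries no information; it is removed first and put back only if the parity at
    \<open>?u\<close> is wrong.\<close>
  define f where "f J = (if odd (card ((J - {e}) \<inter> crossing a b {?u})) \<longleftrightarrow> ?u \<in> T
    then J - {e} else insert e J)" for J
  have "T_join a b V E T (f J)" if J: "J \<in> set_pmf p" for J
  proof -
    have JE: "J \<subseteq> E" and Jp: "\<And>v. v \<in> V' \<Longrightarrow> odd (card (J \<inter> crossing a b (r -` {v}))) \<longleftrightarrow> v \<in> T'"
      using p[OF J] by (auto simp: T_join_def crossing_comp)
    have fJE: "f J \<subseteq> E" using JE e by (auto simp: f_def)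
    have fin: "finite J" "finite (f J)" using JE fJE finite_E finite_subset by blast+
    have off: "f J \<inter> crossing a b S = J \<inter> crossing a b S" if "e \<notin> crossing a b S" for S
      using that by (auto simp: f_def)
    have at_u: "odd (card (f J \<inter> crossing a b {?u})) \<longleftrightarrow> ?u \<in> T"
    proof -
      have "insert e J \<inter> crossing a b {?u} = insert e ((J - {e}) \<inter> crossing a b {?u})"
        using e(2) by (auto simp: crossing_def)
      then have "card (insert e J \<inter> crossing a b {?u}) = Suc (card ((J - {e}) \<inter> crossing a b {?u}))"
        using fin by simp
      then show ?thesis by (auto simp: f_def)
    qed
    have "odd (card (f J \<inter> crossing a b {v})) \<longleftrightarrow> v \<in> T" if v: "v \<in> V" for v
    proof -
      consider "v = ?u" | "v = ?w" | "v \<noteq> ?u" "v \<noteq> ?w" by blast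
      then show ?thesis
      proof cases
        case 1
        then show ?thesis using at_u by simp
      next
        case 2
        have pre: "r -` {?w} = {?u, ?w}" by (auto simp: r_def)
        \<comment> \<open>The edge \<open>e\<close> does not cross \<open>{?u, ?w}\<close>, so the
          parity there is inherited from \<open>J\<close>; subtracting the known parity at
          \<open>?u\<close> leaves the one at \<open>?w\<close>.\<close>
        have "odd (card (f J \<inter> crossing a b {?u, ?w})) \<longleftrightarrow> odd (card (T \<inter> {?u, ?w}))"
          using Jp[of ?w] uw e(2) off[of "{?u, ?w}"] unfolding pre
          by (auto simp: T'_def pre V'_def crossing_def)
        moreover have "odd (card (T \<inter> {?u, ?w})) \<longleftrightarrow> ((?u \<in> T) \<noteq> (?w \<in> T))"
          using e(2) by (auto simp: Int_insert_right)
        ultimately show ?thesis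
          using odd_card_crossing_pair[OF fin(2) e(2), of a b] at_u 2 by blast
      next
        case 3
        then have pre: "r -` {v} = {v}" by (auto simp: r_def)
        show ?thesis
          using Jp[of v] v 3 off[of "{v}"] unfolding pre
          by (auto simp: T'_def pre V'_def crossing_def Int_insert_right)
      qed
    qed
    then show ?thesis
      using fJE by (simp add: T_join_def)
  qed
  then have "\<forall>J\<in>set_pmf (map_pmf f p). T_join a b V E T J" by auto
  moreover have "measure_pmf.prob (map_pmf f p) {J. g \<in> J} \<le> y g" if g: "g \<in> E" for g
  proof (cases "g = e")
    case True
    then show ?thesis using e(3) measure_pmf.prob_le_1 order.trans by blast
  next
    case False
    then have "f -` {J. g \<in> J} = {J. g \<in> J}" by (auto simp: f_def)
    then show ?thesis using py[OF g] by simp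
  qed
  ultimately show ?thesis unfolding join_dominated_def by blast
qed

section \<open>Splitting along a tight cut\<close>

text \<open>Records what a random join of a contracted graph yields in the original graph.
  \<open>W\<close> is the shore on which degrees are still correct; exact marginals on the cut make
  the law of the single crossing edge depend on \<open>y\<close> alone.\<close>

definition crosses_once_outside :: "'v set \<Rightarrow> 'v set \<Rightarrow> 'e set pmf \<Rightarrow> bool" where
  "crosses_once_outside U W p \<longleftrightarrow>
     (\<forall>J\<in>set_pmf p. J \<subseteq> E \<and> card (J \<inter> crossing a b U) = 1 \<and>
        (\<forall>v\<in>W. odd (card (J \<inter> crossing a b {v})) \<longleftrightarrow> v \<in> T)) \<and>
     (\<forall>e\<in>E. measure_pmf.prob p {J. e \<in> J} \<le> y e) \<and>
     (\<forall>e\<in>E \<inter> crossing a b U. measure_pmf.prob p {J. e \<in> J} = y e)"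

lemma crosses_once_outside_compl:
  assumes "crosses_once_outside (V - U) W p"
  shows "crosses_once_outside U W p"
proof -
  have "J \<inter> crossing a b (V - U) = J \<inter> crossing a b U" if "J \<subseteq> E" for J
    using crossing_compl[of U] that by blast
  then show ?thesis
    using assms unfolding crosses_once_outside_def crossing_compl by metis
qed

text \<open>After contracting \<open>U\<close> to \<open>u\<close>, every join crosses
  \<open>U\<close> an odd number of times, hence at least once, while the expected number of
  crossings is at most the cut weight 1. Equality must hold throughout.\<close>

lemma contract_side:
  assumes U: "U \<in> T_odd_sets" "sum y (E \<inter> crossing a b U) = 1" "2 \<le> card U"
    and IH: "\<And>(a' :: 'e \<Rightarrow> 'v) b' V' T'. T_cut_cover a' b' V' E T' y \<Longrightarrow> card V' < card V \<Longrightarrow>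
      join_dominated a' b' V' E T' y"
  shows "\<exists>p. crosses_once_outside U (V - U) p"
proof -
  obtain u where u: "u \<in> U" using T_odd_nonempty[OF U(1)] by blast
  have UV: "U \<subseteq> V" and Uodd: "odd (card (U \<inter> T))" using U(1) by (auto simp: T_odd_sets_def)
  have finU: "finite U" using UV finite_V finite_subset by blast
  define r where "r v = (if v \<in> U then u else v)" for v
  define V' where "V' = insert u (V - U)"
  define T' where "T' = {v \<in> V'. odd (card (T \<inter> r -` {v}))}"
  have cover: "T_cut_cover (r \<circ> a) (r \<circ> b) V' E T' y"
    unfolding T'_def using finite_V by (intro contract) (auto simp: V'_def r_def)
  have "card V' = Suc (card V - card U)"
    unfolding V'_def using u finite_V finU UV by (simp add: card_Diff_subset)
  moreover have "card U \<le> card V" using UV finite_V by (rule card_mono[rotated])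
  ultimately have "card V' < card V" using U(3) by simp
  then have "join_dominated (r \<circ> a) (r \<circ> b) V' E T' y"
    by (rule IH[OF cover])
  then obtain p where p: "\<And>J. J \<in> set_pmf p \<Longrightarrow> T_join (r \<circ> a) (r \<circ> b) V' E T' J"
    and py: "\<And>g. g \<in> E \<Longrightarrow> measure_pmf.prob p {J. g \<in> J} \<le> y g"
    unfolding join_dominated_def by blast
  have JE: "J \<subseteq> E" if "J \<in> set_pmf p" for J using p[OF that] by (simp add: T_join_def)
  have finp: "finite (set_pmf p)"
  proof (rule finite_subset)
    show "set_pmf p \<subseteq> Pow E" using JE by blast
  qed (simp add: finite_E)
  have outside: "odd (card (J \<inter> crossing a b {v})) \<longleftrightarrow> v \<in> T" if J: "J \<in> set_pmf p" and v: "v \<in> V - U" for J v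
  proof -
    have pre: "r -` {v} = {v}" using v u by (auto simp: r_def)
    have "odd (card (J \<inter> crossing a b (r -` {v}))) \<longleftrightarrow> v \<in> T'"
      using p[OF J] v by (simp add: T_join_def crossing_comp V'_def)
    moreover have "v \<in> T' \<longleftrightarrow> v \<in> T"
      using v by (auto simp: T'_def V'_def pre Int_insert_right)
    ultimately show ?thesis by (simp add: pre)
  qed
  have odd_cross: "odd (card (J \<inter> crossing a b U))" if J: "J \<in> set_pmf p" for J
  proof -
    have pre: "r -` {u} = U" using u by (auto simp: r_def split: if_splits)
    then have "u \<in> T'" using Uodd by (simp add: T'_def V'_def Int_commute)
    moreover have "odd (card (J \<inter> crossing a b U)) \<longleftrightarrow> u \<in> T'"
      using p[OF J] by (simp add: T_join_def crossing_comp V'_def pre)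
    ultimately show ?thesis by simp
  qed
  let ?X = "E \<inter> crossing a b U"
  have finX: "finite ?X" using finite_E by simp
  have card_real: "real (card (J \<inter> crossing a b U)) = (\<Sum>e\<in>?X. indicator {J. e \<in> J} J)" if "J \<in> set_pmf p" for J
  proof -
    have "(\<Sum>e\<in>?X. indicator {J. e \<in> J} J :: real) = (\<Sum>e\<in>?X. of_bool (e \<in> J))"
      by (intro sum.cong) (auto simp: indicator_def)
    also have "\<dots> = real (card (?X \<inter> J))" using finX by (simp add: Int_def)
    also have "?X \<inter> J = J \<inter> crossing a b U" using JE[OF that] by auto
    finally show ?thesis by simp
  qed
  have int: "integrable p f" for f :: "'e set \<Rightarrow> real"
    using finp by (rule integrable_measure_pmf_finite)
  have expect: "measure_pmf.expectation p (\<lambda>J. real (card (J \<inter> crossing a b U))) =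
      (\<Sum>e\<in>?X. measure_pmf.prob p {J. e \<in> J})"
  proof -
    have "measure_pmf.expectation p (\<lambda>J. real (card (J \<inter> crossing a b U))) =
        measure_pmf.expectation p (\<lambda>J. \<Sum>e\<in>?X. indicator {J. e \<in> J} J)"
      by (intro integral_cong_AE) (auto simp: AE_measure_pmf_iff card_real)
    also have "\<dots> = (\<Sum>e\<in>?X. measure_pmf.prob p {J. e \<in> J})"
      by (subst Bochner_Integration.integral_sum) (auto intro: int)
    finally show ?thesis .
  qed
  have le: "(\<Sum>e\<in>?X. measure_pmf.prob p {J. e \<in> J}) \<le> sum y ?X"
    by (intro sum_mono py) auto
  \<comment> \<open>The excess over one crossing is nonnegative with expectation at most 0, so it
    vanishes almost surely and the marginals on the cut sum to exactly
    \<open>sum y ?X\<close>.\<close>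
  let ?d = "\<lambda>J. real (card (J \<inter> crossing a b U)) - 1"
  have d_nonneg: "AE J in p. 0 \<le> ?d J"
    unfolding AE_measure_pmf_iff
  proof
    fix J assume "J \<in> set_pmf p"
    then have "card (J \<inter> crossing a b U) \<noteq> 0" using odd_cross[of J] by (intro notI) simp
    then show "0 \<le> ?d J" by linarith
  qed
  have d_int: "measure_pmf.expectation p ?d = (\<Sum>e\<in>?X. measure_pmf.prob p {J. e \<in> J}) - 1"
    using expect by (subst Bochner_Integration.integral_diff) (auto intro: int)
  have "0 \<le> measure_pmf.expectation p ?d"
    using d_nonneg by (rule integral_nonneg_AE)
  then have eq: "(\<Sum>e\<in>?X. measure_pmf.prob p {J. e \<in> J}) = sum y ?X" and d0: "measure_pmf.expectation p ?d = 0"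
    using d_int le U(2) by auto
  have "AE J in p. ?d J = 0"
    using integral_nonneg_eq_0_iff_AE[OF int d_nonneg] d0 by simp
  then have one: "card (J \<inter> crossing a b U) = 1" if "J \<in> set_pmf p" for J
    using that by (auto simp: AE_measure_pmf_iff)
  \<comment> \<open>Termwise inequalities with equal sums are termwise equalities.\<close>
  have "measure_pmf.prob p {J. e \<in> J} = y e" if "e \<in> ?X" for e
    using sum_mono_inv[OF eq _ that finX] py by auto
  then show ?thesis
    using JE one outside py by (intro exI[of _ p]) (simp add: crosses_once_outside_def)
qed

text \<open>The joins from the two contractions use the same law for their one cut edge. Coupled to
  agree on that edge, they can be glued without changing any degree on the shore where each is
  correct.\<close>

lemma dominated_contract_tight:
  assumes U: "U \<in> T_odd_sets" "sum y (E \<inter> crossing a b U) = 1" "2 \<le> card U" "2 \<le> card (V - U)"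
    and IH: "\<And>(a' :: 'e \<Rightarrow> 'v) b' V' T'. T_cut_cover a' b' V' E T' y \<Longrightarrow> card V' < card V \<Longrightarrow>
      join_dominated a' b' V' E T' y"
  shows "join_dominated a b V E T y"
proof -
  let ?C = "crossing a b U"
  obtain p1 where p1: "crosses_once_outside U (V - U) p1"
    using contract_side[OF U(1-3) IH] by blast
  have "V - (V - U) = U" using U(1) by (auto simp: T_odd_sets_def)
  then obtain p2 where p2: "crosses_once_outside U U p2"
    using contract_side[OF T_odd_compl[OF U(1)] _ U(4) IH] U(2) crosses_once_outside_compl[of U U]
    unfolding crossing_compl by auto
  note once = crosses_once_outside_def
  \<comment> \<open>A join meets the cut in one edge, so meeting it in \<open>{e}\<close> is almost
    surely the same event as containing \<open>e\<close>, of probability \<open>y e\<close>. The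
    right-hand side mentions neither \<open>p\<close> nor \<open>W\<close>.\<close>
  have law: "pmf (map_pmf (\<lambda>J. J \<inter> ?C) p) X = (if \<exists>e\<in>E \<inter> ?C. X = {e} then y (the_elem X) else 0)"
    if p: "crosses_once_outside U W p" for p W X
  proof (cases "\<exists>e\<in>E \<inter> ?C. X = {e}")
    case True
    then obtain e where e: "e \<in> E \<inter> ?C" "X = {e}" by blast
    have "pmf (map_pmf (\<lambda>J. J \<inter> ?C) p) X = measure_pmf.prob p {J. J \<inter> ?C = {e}}"
      by (simp add: pmf_map vimage_def e(2))
    also have "\<dots> = measure_pmf.prob p {J. e \<in> J}"
    proof (rule measure_pmf.finite_measure_eq_AE)
      show "AE J in p. (J \<in> {J. J \<inter> ?C = {e}}) = (J \<in> {J. e \<in> J})"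
        unfolding AE_measure_pmf_iff
      proof
        fix J assume "J \<in> set_pmf p"
        then obtain f where "J \<inter> ?C = {f}" using p unfolding once by (meson card_1_singletonE)
        then show "(J \<in> {J. J \<inter> ?C = {e}}) = (J \<in> {J. e \<in> J})" using e(1) by auto
      qed
    qed auto
    also have "\<dots> = y e" using p e(1) unfolding once by blast
    finally show ?thesis using e True by simp
  next
    case False
    have "X \<notin> set_pmf (map_pmf (\<lambda>J. J \<inter> ?C) p)"
    proof
      assume "X \<in> set_pmf (map_pmf (\<lambda>J. J \<inter> ?C) p)"
      then obtain J where "J \<in> set_pmf p" "X = J \<inter> ?C" by auto
      moreover from this obtain e where "J \<inter> ?C = {e}"
        using p unfolding once by (meson card_1_singletonE)
      moreover have "J \<subseteq> E" using p calculation(1) unfolding once by blast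
      ultimately show False using False by blast
    qed
    then show ?thesis using False by (simp add: pmf_eq_0_set_pmf)
  qed
  have "map_pmf (\<lambda>J. J \<inter> ?C) p1 = map_pmf (\<lambda>J. J \<inter> ?C) p2"
    by (rule pmf_eqI) (simp only: law[OF p1] law[OF p2])
  \<comment> \<open>Equality of the two trace distributions is the relational lifting of equality;
    pulling it back along the trace maps gives a coupling \<open>q\<close> of \<open>p1\<close> and
    \<open>p2\<close>.\<close>
  then have "rel_pmf (=) (map_pmf (\<lambda>J. J \<inter> ?C) p1) (map_pmf (\<lambda>J. J \<inter> ?C) p2)"
    by (simp only: pmf.rel_eq)
  then have "rel_pmf (\<lambda>J1 J2. J1 \<inter> ?C = J2 \<inter> ?C) p1 p2"
    by (simp only: pmf.rel_map)
  then obtain q where q: "\<And>J1 J2. (J1, J2) \<in> set_pmf q \<Longrightarrow> J1 \<inter> ?C = J2 \<inter> ?C"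
    and q1: "map_pmf fst q = p1" and q2: "map_pmf snd q = p2"
    by (auto elim!: rel_pmf.cases)
  \<comment> \<open>Edges inside \<open>U\<close> are taken from the second join; cut edges and all
    others from the first.\<close>
  define I where "I = {e. a e \<in> U \<and> b e \<in> U}"
  define f where "f = (\<lambda>(J1, J2). (J1 - I) \<union> (J2 \<inter> I))"
  have "T_join a b V E T (f (J1, J2))" if J: "(J1, J2) \<in> set_pmf q" for J1 J2
  proof -
    have "J1 \<in> set_pmf p1" "J2 \<in> set_pmf p2"
      unfolding q1[symmetric] q2[symmetric] using J by force+
    then have J1: "J1 \<subseteq> E" "\<And>v. v \<in> V - U \<Longrightarrow> odd (card (J1 \<inter> crossing a b {v})) \<longleftrightarrow> v \<in> T"
      and J2: "J2 \<subseteq> E" "\<And>v. v \<in> U \<Longrightarrow> odd (card (J2 \<inter> crossing a b {v})) \<longleftrightarrow> v \<in> T"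
      using p1 p2 unfolding once by blast+
    have "f (J1, J2) \<inter> crossing a b {v} = J1 \<inter> crossing a b {v}" if "v \<notin> U" for v
      using that by (auto simp: f_def I_def crossing_def)
    moreover have "f (J1, J2) \<inter> crossing a b {v} = J2 \<inter> crossing a b {v}" if "v \<in> U" for v
    proof -
      \<comment> \<open>At a vertex of \<open>U\<close>, edges not inside \<open>U\<close> are cut
        edges, on which the two joins agree.\<close>
      have "crossing a b {v} - I \<subseteq> ?C" using that by (auto simp: I_def crossing_def)
      then show ?thesis using q[OF J] unfolding f_def by blast
    qed
    moreover have "f (J1, J2) \<subseteq> E" using J1(1) J2(1) by (auto simp: f_def)
    ultimately show ?thesis
      using J1(2) J2(2) unfolding T_join_def by (metis DiffI)
  qed
  then have "\<forall>J\<in>set_pmf (map_pmf f q). T_join a b V E T J" by auto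
  moreover have "measure_pmf.prob (map_pmf f q) {J. e \<in> J} \<le> y e" if e: "e \<in> E" for e
  proof (cases "e \<in> I")
    case True
    then have "f -` {J. e \<in> J} = snd -` {J. e \<in> J}" by (auto simp: f_def)
    then have "measure_pmf.prob (map_pmf f q) {J. e \<in> J} = measure_pmf.prob p2 {J. e \<in> J}"
      by (simp add: q2[symmetric])
    then show ?thesis using p2 e by (simp add: once)
  next
    case False
    then have "f -` {J. e \<in> J} = fst -` {J. e \<in> J}" by (auto simp: f_def)
    then have "measure_pmf.prob (map_pmf f q) {J. e \<in> J} = measure_pmf.prob p1 {J. e \<in> J}"
      by (simp add: q1[symmetric])
    then show ?thesis using p1 e by (simp add: once)
  qed
  ultimately show ?thesis unfolding join_dominated_def by blast
qed

section \<open>Loose edges and the star case\<close>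

text \<open>Lowering \<open>y e\<close> disturbs no tight constraint, and a join dominated by the
  smaller vector is dominated by \<open>y\<close>.\<close>

lemma dominated_decrease_edge:
  assumes e: "e \<in> E" "0 < y e"
    and loose: "\<And>S. S \<in> T_odd_sets \<Longrightarrow> sum y (E \<inter> crossing a b S) = 1 \<Longrightarrow> e \<notin> crossing a b S"
    and IH: "\<And>w. T_cut_cover a b V E T w \<Longrightarrow> slack_count w < slack_count y \<Longrightarrow> join_dominated a b V E T w"
  shows "join_dominated a b V E T y"
proof -
  define z where "z g = (if g = e then - 1 else 0 :: real)" for g
  have zero: "z g = 0" if "g \<in> E" "y g = 0" for g
    using that e by (auto simp: z_def)
  have tight: "sum z (E \<inter> crossing a b S) = 0"
    if "S \<in> T_odd_sets" "sum y (E \<inter> crossing a b S) = 1" for S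
    using loose[OF that] by (intro sum.neutral) (auto simp: z_def)
  have "z e < 0" by (simp add: z_def)
  then obtain \<epsilon> where \<epsilon>: "0 < \<epsilon>" "T_cut_cover a b V E T (\<lambda>g. y g + \<epsilon> * z g)"
     "slack_count (\<lambda>g. y g + \<epsilon> * z g) < slack_count y"
    using perturb[OF zero tight e(1)] by blast
  show ?thesis
    by (rule join_dominated_mono[OF IH[OF \<epsilon>(2,3)]]) (use \<epsilon>(1) in \<open>auto simp: z_def\<close>)
qed

text \<open>With \<open>A\<close> the tight vertices and \<open>P\<close> the support of
  \<open>y\<close>, counting incidences gives 2|A| \<le> 2|P|. A strict inequality leaves more
  unknowns than equations. In the equality case the support is 2-regular on \<open>A\<close>, and
  alternating signs on a 2-cycle or 4-cycle work.\<close>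

lemma tight_kernel_vector:
  assumes "T \<noteq> {}"
    and small: "\<And>e. e \<in> E \<Longrightarrow> a e \<noteq> b e \<Longrightarrow> y e < 1"
    and tight: "\<And>U. U \<in> T_odd_sets \<Longrightarrow> sum y (E \<inter> crossing a b U) = 1 \<Longrightarrow> card U \<le> 1 \<or> card (V - U) \<le> 1"
    and star: "\<And>e. e \<in> E \<Longrightarrow> 0 < y e \<Longrightarrow> \<exists>v\<in>T. sum y (E \<inter> crossing a b {v}) = 1 \<and> e \<in> crossing a b {v}"
  shows "\<exists>z. (\<forall>e\<in>E. y e = 0 \<longrightarrow> z e = (0 :: real)) \<and>
    (\<forall>v\<in>T. sum y (E \<inter> crossing a b {v}) = 1 \<longrightarrow> sum z (E \<inter> crossing a b {v}) = 0) \<and>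
    (\<exists>e\<in>E. z e \<noteq> 0)"
proof -
  define A where "A = {v \<in> T. sum y (E \<inter> crossing a b {v}) = 1}"
  define P where "P = {e \<in> E. 0 < y e}"
  define D where "D v = P \<inter> crossing a b {v}" for v
  have finA: "finite A" using finite_T by (simp add: A_def)
  have finP: "finite P" using finite_E by (simp add: P_def)
  have sumP: "sum z (E \<inter> crossing a b S) = sum z (P \<inter> crossing a b S)"
    if "\<And>e. e \<in> E \<Longrightarrow> y e = 0 \<Longrightarrow> z e = 0" for z :: "'e \<Rightarrow> real" and S
    using that finite_E y_nonneg by (intro sum.mono_neutral_right) (auto simp: P_def less_le)
  have endpoint: "\<exists>v\<in>A. e \<in> crossing a b {v}" if "e \<in> P" for e
    using star[of e] that by (auto simp: A_def P_def)
  have lt1: "y e < 1" if "e \<in> P" for e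
  proof -
    have "a e \<noteq> b e" using endpoint[OF that] by (auto simp: crossing_def)
    then show ?thesis using small that by (simp add: P_def)
  qed
  have sumD: "sum y (D v) = 1" if "v \<in> A" for v
    using that sumP[of y "{v}"] by (simp add: A_def D_def)
  have finD: "finite (D v)" for v using finP by (simp add: D_def)
  \<comment> \<open>Each weight is below 1 but the weights at a tight vertex sum to 1.\<close>
  have deg: "2 \<le> card (D v)" if "v \<in> A" for v
  proof (rule ccontr)
    assume "\<not> 2 \<le> card (D v)"
    then have "D v = {} \<or> (\<exists>e. D v = {e})" 
      using finD[of v] by (metis card_1_singletonE card_0_eq less_2_cases not_le One_nat_def)
    moreover have "y e < 1" if "D v = {e}" for e
      using lt1[of e] that by (auto simp: D_def)
    ultimately show False using sumD[OF that] by auto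
  qed
  have ends_sub: "{v \<in> A. e \<in> crossing a b {v}} \<subseteq> {a e, b e}" for e
    by (auto simp: crossing_def)
  have ends_le: "card {v \<in> A. e \<in> crossing a b {v}} \<le> 2" for e
    using card_mono[OF _ ends_sub[of e]] card_insert_le_m1[of 2 "{b e}" "a e"] by simp
  have count: "(\<Sum>v\<in>A. card (D v)) = (\<Sum>e\<in>P. card {v \<in> A. e \<in> crossing a b {v}})"
    unfolding D_def Int_def
    using sum.swap_restrict[OF finA finP, of "\<lambda>_ _. 1 :: nat" "\<lambda>v e. e \<in> crossing a b {v}"] by simp
  show ?thesis
  proof (cases "card A < card P")
    case True
    then obtain z where z: "\<exists>e\<in>P. z e \<noteq> 0"
      "\<forall>v\<in>A. (\<Sum>e\<in>P. of_bool (e \<in> crossing a b {v}) * z e) = (0 :: real)"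
      using underdetermined_system_solution[OF finA finP, of "\<lambda>v e. of_bool (e \<in> crossing a b {v})"] by blast
    define z' where "z' e = (if e \<in> P then z e else 0)" for e
    have "sum z' (E \<inter> crossing a b {v}) = 0" if "v \<in> A" for v
    proof -
      have "sum z' (E \<inter> crossing a b {v}) = sum z' (P \<inter> crossing a b {v})"
        by (rule sumP) (simp add: z'_def P_def)
      also have "\<dots> = (\<Sum>e\<in>P. of_bool (e \<in> crossing a b {v}) * z e)"
        using finP by (intro sum.mono_neutral_cong_left) (auto simp: z'_def)
      finally show ?thesis using z(2) that by simp
    qed
    moreover have "\<exists>e\<in>E. z' e \<noteq> 0" using z(1) by (auto simp: z'_def P_def)
    ultimately show ?thesis
      by (intro exI[of _ z']) (auto simp: A_def z'_def P_def)
  next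
    case False
    \<comment> \<open>Here |A| = |P| after all, so every inequality of the count is an equality:
      tight vertices have support degree 2 and both ends of each support edge are tight.\<close>
    have le1: "(\<Sum>v\<in>A. 2) \<le> (\<Sum>v\<in>A. card (D v))" using deg by (rule sum_mono)
    have le2: "(\<Sum>e\<in>P. card {v \<in> A. e \<in> crossing a b {v}}) \<le> (\<Sum>e\<in>P. 2)"
      using ends_le by (rule sum_mono)
    have eq1: "(\<Sum>v\<in>A. 2) = (\<Sum>v\<in>A. card (D v))"
      and eq2: "(\<Sum>e\<in>P. card {v \<in> A. e \<in> crossing a b {v}}) = (\<Sum>e\<in>P. 2)"
      using le1 le2 count False by simp_all
    have deg2: "card (D v) = 2" if "v \<in> A" for v
      using sum_mono_inv[OF eq1 _ that finA] deg by simp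
    have ends2: "card {v \<in> A. e \<in> crossing a b {v}} = 2" if "e \<in> P" for e
      using sum_mono_inv[OF eq2 _ that finP] ends_le by simp
    have ends_A: "a e \<in> A \<and> b e \<in> A" if "e \<in> P" for e
    proof -
      have "card {a e, b e} \<le> 2" by (cases "a e = b e") auto
      then have "{v \<in> A. e \<in> crossing a b {v}} = {a e, b e}"
        using ends2[OF that] by (intro card_seteq[OF _ ends_sub]) auto
      then show ?thesis by blast
    qed
    have other_end: "\<exists>u\<in>A. u \<noteq> v \<and> {a e, b e} = {v, u}" if "e \<in> D v" for e v
      using ends_A[of e] that by (auto simp: D_def crossing_def)
    obtain v where v: "v \<in> A"
    proof -
      obtain t where t: "t \<in> T" using \<open>T \<noteq> {}\<close> by blast
      then have "1 \<le> sum y (E \<inter> crossing a b {t})"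
        using T_sub by (intro covered) auto
      then have "P \<noteq> {}" using sumP[of y "{t}"] by force
      then show thesis using that endpoint by blast
    qed
    obtain e f where ef: "D v = {e, f}" "e \<noteq> f"
      using deg2[OF v] by (meson card_2_iff)
    obtain u where u: "u \<in> A" "u \<noteq> v" "{a e, b e} = {v, u}" using other_end[of e v] ef by auto
    obtain w where w: "w \<in> A" "w \<noteq> v" "{a f, b f} = {v, w}" using other_end[of f v] ef by auto
    have eP: "e \<in> P" and fP: "f \<in> P" using ef by (auto simp: D_def)
    have e_cross: "e \<in> crossing a b S \<longleftrightarrow> (v \<in> S) \<noteq> (u \<in> S)" for S
      using u(3) by (auto simp: crossing_def doubleton_eq_iff)
    have f_cross: "f \<in> crossing a b S \<longleftrightarrow> (v \<in> S) \<noteq> (w \<in> S)" for S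
      using w(3) by (auto simp: crossing_def doubleton_eq_iff)
    show ?thesis
    proof (cases "u = w")
      case True
      \<comment> \<open>\<open>e\<close> and \<open>f\<close> are parallel, so their difference is
        balanced on every cut.\<close>
      define z where "z g = of_bool (g = e) - (of_bool (g = f) :: real)" for g
      have "sum z (E \<inter> crossing a b S) = 0" for S
        using finite_E eP fP e_cross[of S] f_cross[of S] True
        by (simp add: z_def sum_subtractf of_bool_def P_def)
      moreover have "z e \<noteq> 0" using ef by (simp add: z_def)
      ultimately show ?thesis
        using eP fP by (intro exI[of _ z]) (auto simp: z_def P_def)
    next
      case False
      \<comment> \<open>Three consecutive vertices of a support cycle form a \<open>T\<close>-odd
        set. Its cut turns out tight, so \<open>tight\<close> leaves a single vertex outside and the
        cycle has length 4.\<close>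
      define U where "U = {u, v, w}"
      have distinct: "card U = 3" using False u w by (simp add: U_def)
      have AT: "A \<subseteq> T" by (auto simp: A_def)
      then have "U \<subseteq> T" using u v w by (auto simp: U_def)
      then have Uodd: "U \<in> T_odd_sets"
        using T_sub distinct by (auto simp: T_odd_sets_def Int_absorb2)
      have "e \<in> D u" "f \<in> D w"
        using eP fP e_cross f_cross u w by (auto simp: D_def)
      obtain g where g: "D u = {e, g}" "e \<noteq> g"
        using deg2[OF u(1)] \<open>e \<in> D u\<close> by (auto simp: card_2_iff doubleton_eq_iff)
      obtain h where h: "D w = {f, h}" "f \<noteq> h"
        using deg2[OF w(1)] \<open>f \<in> D w\<close> by (auto simp: card_2_iff doubleton_eq_iff)
      have gP: "g \<in> P" and hP: "h \<in> P" using g h by (auto simp: D_def)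
      have ysum: "y e + y f = 1" "y e + y g = 1" "y f + y h = 1"
        using sumD[OF v] sumD[OF u(1)] sumD[OF w(1)] ef g h by simp_all
      have sub: "P \<inter> crossing a b U \<subseteq> {g, h}"
      proof
        fix k assume k: "k \<in> P \<inter> crossing a b U"
        then have "k \<noteq> e" "k \<noteq> f" using e_cross[of U] f_cross[of U] by (auto simp: U_def)
        moreover have "k \<in> D u \<union> D v \<union> D w"
          using k by (auto simp: D_def U_def crossing_def)
        ultimately show "k \<in> {g, h}" using ef g h by auto
      qed
      have ge1: "1 \<le> sum y (P \<inter> crossing a b U)"
        using Uodd covered[of U] sumP[of y U] by (simp add: T_odd_sets_def)
      \<comment> \<open>Only \<open>g\<close> and \<open>h\<close> can leave \<open>U\<close>, and
        one of them alone is too light to cover its cut. In particular \<open>u\<close>,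
        \<open>v\<close>, \<open>w\<close> do not span a triangle.\<close>
      have both: "P \<inter> crossing a b U = {g, h} \<and> g \<noteq> h"
      proof (rule ccontr)
        assume "\<not> ?thesis"
        then consider "P \<inter> crossing a b U = {}" | "P \<inter> crossing a b U = {g}" | "P \<inter> crossing a b U = {h}"
          using sub by blast
        then show False using ge1 lt1[OF gP] lt1[OF hP] by cases auto
      qed
      \<comment> \<open>The weight is \<open>y g + y h\<close> = (1 - \<open>y e\<close>) + (1 -
        \<open>y f\<close>) = 1.\<close>
      then have "sum y (E \<inter> crossing a b U) = 1"
        using ysum sumP[of y U] by simp
      then have "card (V - U) \<le> 1" using tight[OF Uodd] distinct by simp
      moreover have "V - U \<noteq> {}" using T_odd_nonempty[OF Uodd] by blast
      ultimately obtain r where r: "V - U = {r}"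
        using finite_V by (metis card_1_singletonE card_0_eq finite_Diff le_neq_implies_less less_one)
      have Dr: "D r = {g, h}"
      proof -
        have "E \<inter> crossing a b {r} = E \<inter> crossing a b U" using crossing_compl[of U] r by simp
        then show ?thesis using both by (auto simp: D_def P_def)
      qed
      have V: "V \<subseteq> {u, v, w, r}" using r by (auto simp: U_def)
      \<comment> \<open>Alternating signs along the 4-cycle \<open>e\<close>, \<open>f\<close>,
        \<open>h\<close>, \<open>g\<close>.\<close>
      define z where "z k = (if k = e \<or> k = h then 1 else if k = f \<or> k = g then - 1 else 0 :: real)" for k
      have neq: "e \<noteq> h" "f \<noteq> g"
        using both e_cross[of U] f_cross[of U] by (auto simp: U_def)
      have z0: "z k = 0" if "k \<in> E" "y k = 0" for k
        using that eP fP gP hP by (auto simp: z_def P_def)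
      have "sum z (E \<inter> crossing a b {x}) = 0" if "x \<in> A" for x
      proof -
        have "x \<in> {u, v, w, r}" using that AT T_sub V by blast
        moreover have "sum z (E \<inter> crossing a b {x}) = sum z (D x)"
          unfolding D_def using z0 by (rule sumP)
        moreover have "sum z (D u) = 0" "sum z (D v) = 0" "sum z (D w) = 0" "sum z (D r) = 0"
          using ef g h Dr both neq by (auto simp: z_def)
        ultimately show ?thesis by auto
      qed
      moreover have "z e \<noteq> 0" by (simp add: z_def)
      ultimately show ?thesis
        using eP z0 by (intro exI[of _ z]) (auto simp: A_def P_def)
    qed
  qed
qed

text \<open>If \<open>y\<close> were not dominated, each reduction would be blocked, and the blocked
  cases supply the hypotheses of \<open>tight_kernel_vector\<close>. Moving along \<open>z\<close>
  and \<open>- z\<close> reaches two dominated vectors with \<open>y\<close> on the segment between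
  them.\<close>

lemma dominated_step:
  assumes IH_V: "\<And>(a' :: 'e \<Rightarrow> 'v) b' V' T'. T_cut_cover a' b' V' E T' y \<Longrightarrow> card V' < card V \<Longrightarrow>
      join_dominated a' b' V' E T' y"
    and IH: "\<And>w. T_cut_cover a b V E T w \<Longrightarrow> slack_count w < slack_count y \<Longrightarrow> join_dominated a b V E T w"
  shows "join_dominated a b V E T y"
proof (rule ccontr)
  assume contra: "\<not> join_dominated a b V E T y"
  have "T \<noteq> {}"
  proof
    assume "T = {}"
    then have "join_dominated a b V E T y"
      using y_nonneg unfolding join_dominated_def
      by (intro exI[of _ "return_pmf {}"]) (auto simp: T_join_def)
    then show False using contra by blast
  qed
  moreover have "y e < 1" if "e \<in> E" "a e \<noteq> b e" for e
    using dominated_contract_edge[OF that _ IH_V] contra by force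
  moreover have tight: "card U \<le> 1 \<or> card (V - U) \<le> 1"
    if "U \<in> T_odd_sets" "sum y (E \<inter> crossing a b U) = 1" for U
    using dominated_contract_tight[OF that _ _ IH_V] contra by force
  \<comment> \<open>One shore is a single vertex, and being \<open>T\<close>-odd it lies in
    \<open>T\<close>.\<close>
  have single: "\<exists>v\<in>T. E \<inter> crossing a b U = E \<inter> crossing a b {v}"
    if "U \<in> T_odd_sets" "sum y (E \<inter> crossing a b U) = 1" for U
  proof -
    have "\<exists>W\<in>{U, V - U}. card W \<le> 1" using tight[OF that] by blast
    then obtain W where W: "W \<in> {U, V - U}" "card W \<le> 1" by blast
    have Wodd: "W \<in> T_odd_sets" using W(1) that(1) T_odd_compl[OF that(1)] by blast
    then have "W \<noteq> {}" "finite W"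
      using T_odd_nonempty finite_V finite_subset by (auto simp: T_odd_sets_def)
    then obtain v where v: "W = {v}"
      using W(2) by (metis card_1_singletonE card_0_eq le_neq_implies_less less_one)
    have "v \<in> T" using Wodd v by (auto simp: T_odd_sets_def Int_insert_left split: if_splits)
    moreover have "E \<inter> crossing a b U = E \<inter> crossing a b {v}"
      using W(1) v crossing_compl[of U] by auto
    ultimately show ?thesis by blast
  qed
  have star: "\<exists>v\<in>T. sum y (E \<inter> crossing a b {v}) = 1 \<and> e \<in> crossing a b {v}" if e: "e \<in> E" "0 < y e" for e
  proof -
    obtain U where U: "U \<in> T_odd_sets" "sum y (E \<inter> crossing a b U) = 1" "e \<in> crossing a b U"
      using dominated_decrease_edge[OF e _ IH] contra by blast
    obtain v where v: "v \<in> T" "E \<inter> crossing a b U = E \<inter> crossing a b {v}"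
      using single[OF U(1,2)] by blast
    then have "e \<in> E \<inter> crossing a b {v}" using U(3) e(1) by blast
    then show ?thesis using U(2) v by auto
  qed
  ultimately obtain z where z: "\<And>e. e \<in> E \<Longrightarrow> y e = 0 \<Longrightarrow> z e = (0 :: real)"
    "\<And>v. v \<in> T \<Longrightarrow> sum y (E \<inter> crossing a b {v}) = 1 \<Longrightarrow> sum z (E \<inter> crossing a b {v}) = 0"
    "\<exists>e\<in>E. z e \<noteq> 0"
    using tight_kernel_vector[OF _ _ tight star] by blast
  have step: "\<exists>\<epsilon>>0. join_dominated a b V E T (\<lambda>e. y e + \<epsilon> * w e)"
    if w: "\<And>e. e \<in> E \<Longrightarrow> y e = 0 \<Longrightarrow> w e = 0"
      "\<And>v. v \<in> T \<Longrightarrow> sum y (E \<inter> crossing a b {v}) = 1 \<Longrightarrow> sum w (E \<inter> crossing a b {v}) = 0"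
      "\<exists>e\<in>E. w e \<noteq> 0" for w :: "'e \<Rightarrow> real"
  proof -
    obtain e where e: "e \<in> E" "w e \<noteq> 0" using w(3) by blast
    then have "0 < y e" using w(1)[OF e(1)] y_nonneg[OF e(1)] by fastforce
    then obtain v where v: "v \<in> T" "sum y (E \<inter> crossing a b {v}) = 1" "e \<in> crossing a b {v}"
      using star[OF e(1)] by blast
    \<comment> \<open>\<open>w\<close> is nonzero at \<open>e\<close> and sums to zero over a tight
      star containing \<open>e\<close>, so it takes both signs there. This is what bounds the step
      in \<open>perturb\<close>.\<close>
    have "\<exists>f\<in>E. w f < 0"
    proof (rule ccontr)
      assume "\<not> ?thesis"
      then have nonneg: "0 \<le> w f" if "f \<in> E \<inter> crossing a b {v}" for f
        using that by force
      have "w e = 0"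
        using sum_nonneg_eq_0_iff[of "E \<inter> crossing a b {v}" w] finite_E nonneg w(2)[OF v(1,2)] e(1) v(3)
        by auto
      then show False using e(2) by blast
    qed
    then obtain f where f: "f \<in> E" "w f < 0" by blast
    have w_tight: "sum w (E \<inter> crossing a b S) = 0" if S: "S \<in> T_odd_sets" "sum y (E \<inter> crossing a b S) = 1" for S
    proof -
      obtain v where v: "v \<in> T" "E \<inter> crossing a b S = E \<inter> crossing a b {v}"
        using single[OF S] by blast
      then show ?thesis using w(2)[OF v(1)] S(2) by simp
    qed
    obtain \<epsilon> where "0 < \<epsilon>" "T_cut_cover a b V E T (\<lambda>e. y e + \<epsilon> * w e)"
      "slack_count (\<lambda>e. y e + \<epsilon> * w e) < slack_count y"
      using perturb[OF w(1) w_tight f] by blast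
    then show ?thesis using IH by blast
  qed
  obtain \<epsilon>1 where \<epsilon>1: "0 < \<epsilon>1" "join_dominated a b V E T (\<lambda>e. y e + \<epsilon>1 * z e)"
    using step[OF z] by blast
  obtain \<epsilon>2 where \<epsilon>2: "0 < \<epsilon>2" "join_dominated a b V E T (\<lambda>e. y e + \<epsilon>2 * - z e)"
    using step[of "\<lambda>e. - z e"] z by (auto simp: sum_negf)
  \<comment> \<open>The weight at which the displacements by \<open>\<epsilon>1\<close> and
    \<open>\<epsilon>2\<close> cancel.\<close>
  let ?l = "\<epsilon>2 / (\<epsilon>1 + \<epsilon>2)"
  have l: "0 \<le> ?l" "?l \<le> 1" using \<epsilon>1(1) \<epsilon>2(1) by simp_all
  have "?l * (y e + \<epsilon>1 * z e) + (1 - ?l) * (y e + \<epsilon>2 * - z e) = y e" for e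
  proof -
    have "1 - ?l = \<epsilon>1 / (\<epsilon>1 + \<epsilon>2)" using \<epsilon>1(1) \<epsilon>2(1) by (simp add: field_simps)
    then have "?l * \<epsilon>1 - (1 - ?l) * \<epsilon>2 = 0" by simp
    then show ?thesis by algebra
  qed
  then show False
    using join_dominated_convex[OF \<epsilon>1(2) \<epsilon>2(2) l] contra by simp
qed

end

text \<open>Contractions shrink \<open>V\<close> with \<open>E\<close> and \<open>y\<close> fixed;
  moves of \<open>y\<close> lower \<open>slack_count\<close> with the graph fixed. Hence the nested
  inductions.\<close>

theorem T_cut_cover_dominates_join:
  assumes "T_cut_cover a b V E T y"
  shows "join_dominated a b V E T y"
  using assms
proof (induction "card V" arbitrary: a b V T y rule: less_induct)
  case less
  note IH_V = less.hyps
  show ?case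
    using less.prems
  proof (induction "T_cut_cover.slack_count a b V E T y" arbitrary: y rule: less_induct)
    case less
    interpret T_cut_cover a b V E T y by fact
    show ?case
      by (rule dominated_step) (use IH_V less.hyps in blast)+
  qed
qed

section \<open>Joins for the decomposition trees\<close>

lemma finite_complete_edges: "finite V \<Longrightarrow> finite (complete_edges V)"
  unfolding complete_edges_def by (rule finite_subset[of _ "Pow V"]) auto

text \<open>An arbitrary orientation of the edges links two-element sets to labelled edges.\<close>

lemma edge_endpoints:
  obtains a b where "\<And>e. e \<in> complete_edges V \<Longrightarrow> a e \<in> V \<and> b e \<in> V"
    and "\<And>S. edge_cut V S = complete_edges V \<inter> crossing a b S"
proof -
  have "\<forall>e\<in>complete_edges V. \<exists>ab. e = {fst ab, snd ab} \<and> fst ab \<noteq> snd ab"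
    unfolding complete_edges_def by (auto simp: card_2_iff)
  then obtain f where f: "\<And>e. e \<in> complete_edges V \<Longrightarrow> e = {fst (f e), snd (f e)} \<and> fst (f e) \<noteq> snd (f e)"
    using bchoice[of "complete_edges V" "\<lambda>e ab. e = {fst ab, snd ab} \<and> fst ab \<noteq> snd ab"] by blast
  have "fst (f e) \<in> V \<and> snd (f e) \<in> V" if "e \<in> complete_edges V" for e
  proof -
    have "{fst (f e), snd (f e)} \<subseteq> V"
      using f[OF that] that by (auto simp: complete_edges_def)
    then show ?thesis by simp
  qed
  moreover have "edge_cut V S = complete_edges V \<inter> crossing (fst \<circ> f) (snd \<circ> f) S" for S
  proof -
    have "card (e \<inter> S) = 1 \<longleftrightarrow> e \<in> crossing (fst \<circ> f) (snd \<circ> f) S" if "e \<in> complete_edges V" for e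
    proof -
      obtain u v where uv: "f e = (u, v)" by fastforce
      then have e: "e = {u, v}" "u \<noteq> v" using f[OF that] by auto
      show ?thesis unfolding crossing_def e(1)
        using e uv by (auto simp: Int_insert_left)
    qed
    then show ?thesis by (auto simp: edge_cut_def)
  qed
  ultimately show thesis using that[of "fst \<circ> f" "snd \<circ> f"] by simp
qed

lemma edge_degree_eq_card_cut:
  assumes "F \<subseteq> complete_edges V"
  shows "edge_degree F v = card (F \<inter> edge_cut V {v})"
proof -
  have "{e \<in> F. v \<in> e} = F \<inter> edge_cut V {v}"
    using assms by (auto simp: edge_cut_def card_1_singleton_iff)
  then show ?thesis by (simp add: edge_degree_def)
qed

lemma odd_card_edge_cut:
  assumes "finite V" "F \<subseteq> complete_edges V" "S \<subseteq> V"
  shows "odd (card (F \<inter> edge_cut V S)) \<longleftrightarrow> odd (card (S \<inter> {v \<in> V. odd (edge_degree F v)}))"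
proof -
  obtain a b :: "'a set \<Rightarrow> 'a" where cut: "\<And>S. edge_cut V S = complete_edges V \<inter> crossing a b S"
    using edge_endpoints[of V] by metis
  have eq: "F \<inter> edge_cut V S = F \<inter> crossing a b S" for S
    using assms(2) cut by auto
  have "finite F" "finite S"
    using assms finite_complete_edges finite_subset by blast+
  moreover have "S \<inter> {v \<in> V. odd (edge_degree F v)} = {v \<in> S. odd (edge_degree F v)}"
    using assms(3) by auto
  ultimately show ?thesis
    using odd_card_crossing[of F S a b] by (simp only: eq edge_degree_eq_card_cut[OF assms(2)])
qed

text \<open>A minimum costs no more than the average over the random join, and with nonnegative
  costs that average is bounded through the marginals.\<close>

lemma min_cost_join_le_cover:
  assumes "finite V" "T \<subseteq> V" "even (card T)"
    and c: "\<And>e. e \<in> complete_edges V \<Longrightarrow> 0 \<le> c e"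
    and y: "\<And>e. e \<in> complete_edges V \<Longrightarrow> 0 \<le> y e"
    and cover: "\<And>S. S \<subseteq> V \<Longrightarrow> odd (card (S \<inter> T)) \<Longrightarrow> 1 \<le> sum y (edge_cut V S)"
    and J: "min_cost_join V c T J"
  shows "sum c J \<le> cost V c y"
proof -
  let ?E = "complete_edges V"
  obtain a b :: "'a set \<Rightarrow> 'a" where ab: "\<And>e. e \<in> ?E \<Longrightarrow> a e \<in> V \<and> b e \<in> V"
    and cut: "\<And>S. edge_cut V S = ?E \<inter> crossing a b S"
    using edge_endpoints[of V] by metis
  have finE: "finite ?E" using assms(1) by (rule finite_complete_edges)
  have "T_cut_cover a b V ?E T y"
    using assms(1-3) finE ab y cover unfolding cut by unfold_locales auto
  then obtain p where p: "\<And>J'. J' \<in> set_pmf p \<Longrightarrow> T_join a b V ?E T J'"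
    and py: "\<And>e. e \<in> ?E \<Longrightarrow> measure_pmf.prob p {J'. e \<in> J'} \<le> y e"
    using T_cut_cover_dominates_join unfolding join_dominated_def by blast
  have sub: "J' \<subseteq> ?E" if "J' \<in> set_pmf p" for J'
    using p[OF that] by (simp add: T_join_def)
  have le: "sum c J \<le> sum c J'" if J': "J' \<in> set_pmf p" for J'
  proof -
    have "edge_degree J' v = card (J' \<inter> crossing a b {v})" for v
    proof -
      have "J' \<inter> edge_cut V {v} = J' \<inter> crossing a b {v}" using sub[OF J'] cut by auto
      then show ?thesis using edge_degree_eq_card_cut[OF sub[OF J']] by simp
    qed
    then have "is_join V T J'"
      using p[OF J'] assms(2) by (auto simp: T_join_def is_join_def)
    then show ?thesis using J by (auto simp: min_cost_join_def)
  qed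
  have finp: "finite (set_pmf p)"
  proof (rule finite_subset)
    show "set_pmf p \<subseteq> Pow ?E" using sub by blast
  qed (simp add: finE)
  have int: "integrable p f" for f :: "'a set set \<Rightarrow> real"
    using finp by (rule integrable_measure_pmf_finite)
  have "sum c J' = (\<Sum>e\<in>?E. c e * indicator {J'. e \<in> J'} J')" if "J' \<in> set_pmf p" for J'
    using sub[OF that] finE by (intro sum.mono_neutral_cong_left) (auto simp: indicator_def)
  then have "AE J' in p. sum c J \<le> (\<Sum>e\<in>?E. c e * indicator {J'. e \<in> J'} J')"
    using le by (simp add: AE_measure_pmf_iff)
  then have "sum c J \<le> measure_pmf.expectation p (\<lambda>J'. \<Sum>e\<in>?E. c e * indicator {J'. e \<in> J'} J')"
    by (intro measure_pmf.integral_ge_const int)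
  also have "\<dots> = (\<Sum>e\<in>?E. c e * measure_pmf.prob p {J'. e \<in> J'})"
    by (subst Bochner_Integration.integral_sum) (auto intro: int)
  also have "\<dots> \<le> cost V c y"
    unfolding cost_def using c py by (intro sum_mono mult_left_mono) auto
  finally show ?thesis .
qed

lemma odd_card_symmetric_difference:
  assumes "finite A" "finite B"
  shows "odd (card ((A - B) \<union> (B - A))) \<longleftrightarrow> (odd (card A) \<noteq> odd (card B))"
proof -
  have "card ((A - B) \<union> (B - A)) = card (A - B) + card (B - A)"
    using assms by (intro card_Un_disjoint) auto
  moreover have "card A = card (A - B) + card (A \<inter> B)" "card B = card (B - A) + card (A \<inter> B)"
    using assms card_Int_Diff[of A B] card_Int_Diff[of B A] by (simp_all add: Int_commute)
  ultimately show ?thesis by auto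
qed

text \<open>The wrong-degree vertices are the symmetric difference of the odd-degree vertices and
  \<open>{s, t}\<close>, so parities add.\<close>

lemma odd_card_wrong_degree_set:
  assumes "finite V" "s \<in> V" "t \<in> V"
  shows "odd (card (S \<inter> wrong_degree_set V s t F)) \<longleftrightarrow>
    (odd (card (S \<inter> {v \<in> V. odd (edge_degree F v)})) \<noteq> odd (card (S \<inter> {s, t})))"
proof -
  let ?O = "{v \<in> V. odd (edge_degree F v)}"
  have "S \<inter> wrong_degree_set V s t F = (S \<inter> ?O - S \<inter> {s, t}) \<union> (S \<inter> {s, t} - S \<inter> ?O)"
    using assms(2,3) by (auto simp: wrong_degree_set_def)
  then show ?thesis
    using assms(1) odd_card_symmetric_difference[of "S \<inter> ?O" "S \<inter> {s, t}"] by simp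
qed

text \<open>A walk in \<open>F\<close> from inside \<open>S\<close> to outside has a step that
  leaves \<open>S\<close>.\<close>

lemma connected_edges_meets_cut:
  assumes "F \<subseteq> complete_edges V" "connected_edges V F" "S \<subset> V" "S \<noteq> {}"
  shows "F \<inter> edge_cut V S \<noteq> {}"
proof -
  obtain u v where uv: "u \<in> S" "v \<in> V" "v \<notin> S" using assms(3,4) by blast
  then have "(u, v) \<in> {(a, b). {a, b} \<in> F}\<^sup>*"
    using assms(2,3) by (auto simp: connected_edges_def)
  then have "v \<notin> S \<longrightarrow> (\<exists>a b. {a, b} \<in> F \<and> a \<in> S \<and> b \<notin> S)"
    by (induction rule: rtrancl_induct) (use uv in auto)
  then obtain a b where "{a, b} \<in> F" "a \<in> S" "b \<notin> S" using uv by blast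
  then have "{a, b} \<in> F \<inter> edge_cut V S"
    using assms(1) by (auto simp: edge_cut_def)
  then show ?thesis by blast
qed

text \<open>The tree crosses a wrong-degree-odd set separating \<open>s\<close> from \<open>t\<close> an even number of times, hence
  at least twice; this makes up for the weaker bound on \<open>x\<close> there.\<close>

lemma tree_plus_solution_cut_ge_3:
  assumes "finite V" "s \<in> V" "t \<in> V" "s \<noteq> t"
    and x: "held_karp_path_feasible V s t x" and F: "spanning_tree V F"
    and S: "S \<subseteq> V" "odd (card (S \<inter> wrong_degree_set V s t F))"
  shows "3 \<le> real (card (F \<inter> edge_cut V S)) + sum x (edge_cut V S)"
proof -
  have FE: "F \<subseteq> complete_edges V" and conn: "connected_edges V F"
    using F by (auto simp: spanning_tree_def)
  have parity: "odd (card (W \<inter> wrong_degree_set V s t F)) \<longleftrightarrow>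
      (odd (card (F \<inter> edge_cut V W)) \<noteq> odd (card (W \<inter> {s, t})))" if "W \<subseteq> V" for W
    using odd_card_wrong_degree_set[OF assms(1-3)] odd_card_edge_cut[OF assms(1) FE that] by simp
  \<comment> \<open>\<open>V\<close> has an empty cut and contains both terminals, so it is not
    wrong-degree-odd. Thus \<open>S\<close> is proper and the constraints of the relaxation apply to
    it.\<close>
  have "edge_cut V V = {}" by (auto simp: edge_cut_def complete_edges_def Int_absorb2)
  then have "S \<noteq> V" using S parity[of V] assms(2-4) by (auto simp: Int_absorb1)
  then have SV: "S \<subset> V" using S(1) by blast
  have Sne: "S \<noteq> {}" using S(2) by auto
  have "finite (F \<inter> edge_cut V S)"
    using FE finite_complete_edges[OF assms(1)] finite_subset by blast
  then have ge1: "1 \<le> card (F \<inter> edge_cut V S)"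
    using connected_edges_meets_cut[OF FE conn SV Sne] by (simp add: Suc_le_eq card_gt_0_iff)
  show ?thesis
  proof (cases "card (S \<inter> {s, t}) = 1")
    case True
    then have "even (card (F \<inter> edge_cut V S))" using S parity[of S] by simp
    then have "2 \<le> card (F \<inter> edge_cut V S)" using ge1 by presburger
    moreover have "1 \<le> sum x (edge_cut V S)"
      using x SV True by (simp add: held_karp_path_feasible_def)
    ultimately show ?thesis by simp
  next
    case False
    then have "2 \<le> sum x (edge_cut V S)"
      using x SV Sne by (simp add: held_karp_path_feasible_def)
    then show ?thesis using ge1 by simp
  qed
qed

lemma join_cost_le_third:
  assumes "finite V" "s \<in> V" "t \<in> V" "s \<noteq> t" "metric_cost V c"
    and x: "held_karp_path_feasible V s t x" and F: "spanning_tree V F"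
    and J: "min_cost_join V c (wrong_degree_set V s t F) J"
  shows "sum c J \<le> (sum c F + cost V c x) / 3"
proof -
  let ?E = "complete_edges V" and ?T = "wrong_degree_set V s t F"
  have FE: "F \<subseteq> ?E" using F by (simp add: spanning_tree_def)
  have finE: "finite ?E" using assms(1) by (rule finite_complete_edges)
  \<comment> \<open>Dividing by 3 turns the bound of \<open>tree_plus_solution_cut_ge_3\<close> into
    the covering condition.\<close>
  define y where "y e = (indicator F e + x e) / 3" for e
  have TV: "?T \<subseteq> V" using assms(2,3) by (auto simp: wrong_degree_set_def)
  have "edge_cut V V = {}" by (auto simp: edge_cut_def complete_edges_def Int_absorb2)
  then have evenT: "even (card ?T)"
    using odd_card_wrong_degree_set[OF assms(1-3), of V F] odd_card_edge_cut[OF assms(1) FE, of V]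
      assms(2-4) TV by (simp add: Int_absorb1)
  have sum_ind: "(\<Sum>e\<in>A. g e * indicator F e) = sum g (F \<inter> A)" if "finite A" for A and g :: "'a set \<Rightarrow> real"
    using that by (intro sum.mono_neutral_cong_right) (auto simp: indicator_def)
  have "sum c J \<le> cost V c y"
  proof (rule min_cost_join_le_cover[OF assms(1) TV evenT _ _ _ J])
    fix S assume S: "S \<subseteq> V" "odd (card (S \<inter> ?T))"
    have "finite (edge_cut V S)" using finE by (simp add: edge_cut_def)
    then have "sum y (edge_cut V S) = (real (card (F \<inter> edge_cut V S)) + sum x (edge_cut V S)) / 3"
      using sum_ind[of "edge_cut V S" "\<lambda>_. 1"]
      by (simp add: y_def sum.distrib flip: sum_divide_distrib)
    then show "1 \<le> sum y (edge_cut V S)"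
      using tree_plus_solution_cut_ge_3[OF assms(1-4) x F S] by simp
  qed (use assms(5) x in \<open>auto simp: metric_cost_def y_def held_karp_path_feasible_def\<close>)
  also have "cost V c y = (sum c F + cost V c x) / 3"
    using sum_ind[OF finE, of c] FE
    by (simp add: cost_def y_def sum.distrib distrib_left Int_absorb2 flip: sum_divide_distrib)
  finally show ?thesis .
qed

section \<open>Shortcutting\<close>

text \<open>Taking a distance on vertex pairs instead of an edge cost allows distance 0 from a
  vertex to itself, where \<open>c {u, u}\<close> would be uncontrolled.\<close>

definition walk_length :: "('a \<Rightarrow> 'a \<Rightarrow> real) \<Rightarrow> 'a list \<Rightarrow> real" where
  "walk_length d p = sum_list (map2 d p (tl p))"

lemma walk_length_simps [simp]:
  "walk_length d [] = 0" "walk_length d [u] = 0"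
  "walk_length d (u # v # p) = d u v + walk_length d (v # p)"
  by (simp_all add: walk_length_def)

text \<open>Vertices are deleted one at a time behind a fixed first vertex \<open>u\<close>: an
  inner deletion costs nothing by the triangle inequality, a final one by nonnegativity.\<close>

lemma walk_length_subseq_le:
  assumes nonneg: "\<And>u v. u \<in> V \<Longrightarrow> v \<in> V \<Longrightarrow> 0 \<le> d u v"
    and triangle: "\<And>u v w. u \<in> V \<Longrightarrow> v \<in> V \<Longrightarrow> w \<in> V \<Longrightarrow> d u w \<le> d u v + d v w"
    and "subseq h p" "u \<in> V" "set p \<subseteq> V"
  shows "walk_length d (u # h) \<le> walk_length d (u # p)"
  using assms(3-5)
proof (induction p arbitrary: u h rule: list.induct)
  case Nil
  then have "h = []" by simp
  then show ?case by simp
next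
  case (Cons v p)
  show ?case
  proof (cases "subseq h p")
    case True
    then have "walk_length d (u # h) \<le> walk_length d (u # p)"
      using Cons by simp
    also have "\<dots> \<le> walk_length d (u # v # p)"
      using Cons.prems nonneg triangle[of u v] by (cases p) auto
    finally show ?thesis .
  next
    case False
    then obtain h' where "h = v # h'" "subseq h' p"
      using Cons.prems(1) by (cases h) (auto split: if_splits)
    then show ?thesis using Cons by simp
  qed
qed

lemma walk_cost_eq_walk_length:
  assumes "\<forall>e\<in>set (walk_edges p). card e = 2"
  shows "walk_cost c p = walk_length (\<lambda>u v. if u = v then 0 else c {u, v}) p"
  using assms by (induction p rule: induct_list012) (auto simp: walk_cost_def walk_edges_def)

lemma card_walk_edges_distinct:
  assumes "distinct p" "e \<in> set (walk_edges p)"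
  shows "card e = 2"
  using assms by (induction p rule: induct_list012) (auto simp: walk_edges_def)

lemma shortcut_cost_le:
  assumes "metric_cost V c" and p: "eulerian_path V M s t p" and h: "shortcut_path V s t p h"
    and M: "set_mset M \<subseteq> complete_edges V"
  shows "walk_cost c h \<le> sum_mset (image_mset c M)"
proof -
  \<comment> \<open>The value 0 on the diagonal extends the triangle inequality to triples with
    repeated vertices, which occur when a closed detour is cut out.\<close>
  let ?d = "\<lambda>u v. if u = v then 0 else c {u, v}"
  have nonneg: "0 \<le> ?d u v" if "u \<in> V" "v \<in> V" for u v
    using assms(1) that by (auto simp: metric_cost_def complete_edges_def)
  have triangle: "?d u w \<le> ?d u v + ?d v w" if "u \<in> V" "v \<in> V" "w \<in> V" for u v w
    using assms(1) that nonneg[of u v] by (auto simp: metric_cost_def insert_commute)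
  have h': "h \<noteq> []" "hd h = s" "distinct h" "subseq h p"
    using h by (auto simp: shortcut_path_def hamiltonian_path_def)
  have p': "p \<noteq> []" "hd p = s" "set p = V" "mset (walk_edges p) = M"
    using p by (auto simp: eulerian_path_def)
  obtain hs ps where hp: "h = s # hs" "p = s # ps"
    using h' p' by (metis list.collapse)
  then have "subseq hs ps" "s \<in> V" "set ps \<subseteq> V" using h' p' by auto
  then have "walk_length ?d h \<le> walk_length ?d p"
    unfolding hp by (intro walk_length_subseq_le[where V = V] nonneg triangle)
  moreover have "walk_cost c h = walk_length ?d h"
    using card_walk_edges_distinct[OF h'(3)] by (intro walk_cost_eq_walk_length) blast
  moreover have "walk_cost c p = walk_length ?d p"
  proof (rule walk_cost_eq_walk_length)
    have "set (walk_edges p) \<subseteq> complete_edges V" using M p'(4) set_mset_mset by metis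
    then show "\<forall>e\<in>set (walk_edges p). card e = 2" by (auto simp: complete_edges_def)
  qed
  moreover have "walk_cost c p = sum_mset (image_mset c M)"
    by (simp add: walk_cost_def p'(4)[symmetric] flip: sum_mset_sum_list)
  ultimately show ?thesis by simp
qed

section \<open>Averaging over the sampled tree\<close>

theorem theorem6:
  fixes V :: "'a set" and s t :: 'a and c x :: "'a set \<Rightarrow> real"
    and k :: nat and lam :: "nat \<Rightarrow> real" and Tr :: "nat \<Rightarrow> 'a set set"
    and p :: "nat pmf"
    and J :: "nat \<Rightarrow> 'a set set" and P H :: "nat \<Rightarrow> 'a list"
  assumes "finite V" and "s \<in> V" and "t \<in> V" and "s \<noteq> t"
    and "metric_cost V c"
    and "held_karp_path_optimal V s t c x"
    and "\<And>i. i \<in> {1..k} \<Longrightarrow> spanning_tree V (Tr i)"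
    and "\<And>i. i \<in> {1..k} \<Longrightarrow> 0 \<le> lam i" and "(\<Sum>i=1..k. lam i) = 1"
    and "\<And>e. e \<in> complete_edges V \<Longrightarrow> x e = (\<Sum>i=1..k. lam i * indicator (Tr i) e)"
    and "\<And>i. pmf p i = (if i \<in> {1..k} then lam i else 0)"
    and "\<And>i. i \<in> {1..k} \<Longrightarrow> min_cost_join V c (wrong_degree_set V s t (Tr i)) (J i)"
    and "\<And>i. i \<in> {1..k} \<Longrightarrow>
           eulerian_path V (mset_set (Tr i) + mset_set (J i)) s t (P i)"
    and "\<And>i. i \<in> {1..k} \<Longrightarrow> shortcut_path V s t (P i) (H i)"
  shows "measure_pmf.expectation p (\<lambda>i. walk_cost c (H i)) \<le> 5 / 3 * cost V c x"
proof -
  let ?E = "complete_edges V" and ?X = "cost V c x"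
  have finE: "finite ?E" using assms(1) by (rule finite_complete_edges)
  have feas: "held_karp_path_feasible V s t x"
    using assms(6) by (simp add: held_karp_path_optimal_def)
  have tree_sub: "Tr i \<subseteq> ?E" if "i \<in> {1..k}" for i
    using assms(7)[OF that] by (simp add: spanning_tree_def)
  \<comment> \<open>The tree is paid for once, and the join adds a third of the tree and a third of
    \<open>x\<close>.\<close>
  have path_cost: "walk_cost c (H i) \<le> 4 / 3 * sum c (Tr i) + ?X / 3" if i: "i \<in> {1..k}" for i
  proof -
    have JE: "J i \<subseteq> ?E"
      using assms(12)[OF i] by (simp add: min_cost_join_def is_join_def)
    have fin: "finite (Tr i)" "finite (J i)"
      using tree_sub[OF i] JE finE finite_subset by blast+
    have "walk_cost c (H i) \<le> sum c (Tr i) + sum c (J i)"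
      using shortcut_cost_le[OF assms(5) assms(13)[OF i] assms(14)[OF i]] fin JE tree_sub[OF i]
      by (simp add: sum_unfold_sum_mset)
    moreover have "sum c (J i) \<le> (sum c (Tr i) + ?X) / 3"
      using join_cost_le_third[OF assms(1-5) feas assms(7)[OF i] assms(12)[OF i]] .
    ultimately show ?thesis by (simp add: field_simps)
  qed
  \<comment> \<open>By linearity the expected tree cost is exactly \<open>?X\<close>, so the average
    is 4/3 + 1/3 = 5/3 of it.\<close>
  have tree_cost: "(\<Sum>i=1..k. lam i * sum c (Tr i)) = ?X"
  proof -
    have "?X = (\<Sum>e\<in>?E. \<Sum>i=1..k. lam i * (c e * indicator (Tr i) e))"
      unfolding cost_def
    proof (intro sum.cong refl)
      fix e assume "e \<in> ?E"
      then have "c e * x e = c e * (\<Sum>i=1..k. lam i * indicator (Tr i) e)"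
        using assms(10) by metis
      also have "\<dots> = (\<Sum>i=1..k. lam i * (c e * indicator (Tr i) e))"
        unfolding sum_distrib_left by (simp only: mult.left_commute)
      finally show "c e * x e = (\<Sum>i=1..k. lam i * (c e * indicator (Tr i) e))" .
    qed
    also have "\<dots> = (\<Sum>i=1..k. lam i * (\<Sum>e\<in>?E. c e * indicator (Tr i) e))"
      by (subst sum.swap) (simp add: sum_distrib_left)
    also have "\<dots> = (\<Sum>i=1..k. lam i * sum c (Tr i))"
    proof (intro sum.cong refl)
      fix i assume "i \<in> {1..k}"
      then have "(\<Sum>e\<in>?E. c e * indicator (Tr i) e) = sum c (Tr i)"
        using tree_sub[of i] finE by (intro sum.mono_neutral_cong_right) (auto simp: indicator_def)
      then show "lam i * (\<Sum>e\<in>?E. c e * indicator (Tr i) e) = lam i * sum c (Tr i)" by simp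
    qed
    finally show ?thesis by simp
  qed
  have "measure_pmf.expectation p (\<lambda>i. walk_cost c (H i)) = (\<Sum>i=1..k. walk_cost c (H i) * pmf p i)"
    using assms(11) by (intro integral_measure_pmf_real) (auto simp: set_pmf_iff split: if_splits)
  also have "\<dots> = (\<Sum>i=1..k. lam i * walk_cost c (H i))"
    using assms(11) by (intro sum.cong) simp_all
  also have "\<dots> \<le> (\<Sum>i=1..k. lam i * (4 / 3 * sum c (Tr i) + ?X / 3))"
    using assms(8) path_cost by (intro sum_mono mult_left_mono) auto
  also have "\<dots> = 4 / 3 * (\<Sum>i=1..k. lam i * sum c (Tr i)) + (\<Sum>i=1..k. lam i) * (?X / 3)"
  proof -
    have "lam i * (4 / 3 * a + ?X / 3) = 4 / 3 * (lam i * a) + lam i * (?X / 3)" for i a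
      by (simp add: algebra_simps)
    then show ?thesis by (simp only: sum.distrib flip: sum_distrib_left sum_distrib_right)
  qed
  also have "\<dots> = 5 / 3 * ?X"
    using tree_cost assms(9) by simp
  finally show ?thesis .
qed

end
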